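(* Let $g_0=dr^2+f(r)^2d\theta^2$ be a smooth rotationally symmetric metric on $M=\mathbb{S}^1\times[-\rho,\rho]$ with $A_{g_0}(M)=1$, $R_{g_0}\ge0$, $k_{g_0}\le0$, which is symmetric under the reflection $r\mapsto -r$ and whose scalar curvature $R_{g_0}$, as a function of $r$, is nonincreasing in $|r|$. Then the scalar curvature of the normalised flow starting at $g_0$ is uniformly bounded: $\sup_{M\times[0,\infty)}R<\infty$.
   Context: $R$ denotes scalar curvature, $k_g$ the geodesic curvature of $\partial M$ w.r.t. the outward normal. The unnormalised flow solves $\partial_{\tilde t}\tilde g=-\tilde R\tilde g$, $k_{\tilde g}=k_{g_0}$ on $\partial M$, $\tilde g(0)=g_0$. The normalised flow is $g=\phi\tilde g$ with $\phi(\tilde t)$ chosen so that $A_g(M)=1$, reparametrised by $t=\int_0^{\tilde t}\phi(\tau)d\tau$; it solves $\partial_t g=(r-R)g$, $k_g=k_{g_0}/\sqrt{\phi}$ on $\partial M$, $g(0)=g_0$, with $r=\int_M R\,dA_g$; it exists for all time. Rotational symmetry, reflection symmetry and the property of curvature decreasing from the middle are preserved by the flow. *)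

theory Defs
  imports "HOL-Analysis.Analysis"
begin

text \<open>Rotationally symmetric metrics on the cylinder M = S^1 x [-rho, rho], written in the
  warped form  a(r)^2 dr^2 + b(r)^2 dtheta^2  with a, b > 0 (theta in [0, 2 pi)).\<close>

text \<open>Scalar curvature R = 2K, with K = -(1/(a b)) d/dr (b'/a).\<close>
definition scal_rot :: "(real \<Rightarrow> real) \<Rightarrow> (real \<Rightarrow> real) \<Rightarrow> real \<Rightarrow> real" where
  "scal_rot a b r = - 2 / (a r * b r) * deriv (\<lambda>s. deriv b s / a s) r"

text \<open>Geodesic curvature w.r.t. the outward normal of the boundary circles r = rho and r = -rho.\<close>
definition geod_curv_top :: "(real \<Rightarrow> real) \<Rightarrow> (real \<Rightarrow> real) \<Rightarrow> real \<Rightarrow> real" where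
  "geod_curv_top a b \<rho> = deriv b \<rho> / (a \<rho> * b \<rho>)"

definition geod_curv_bot :: "(real \<Rightarrow> real) \<Rightarrow> (real \<Rightarrow> real) \<Rightarrow> real \<Rightarrow> real" where
  "geod_curv_bot a b \<rho> = - deriv b (-\<rho>) / (a (-\<rho>) * b (-\<rho>))"

definition area_rot :: "(real \<Rightarrow> real) \<Rightarrow> (real \<Rightarrow> real) \<Rightarrow> real \<Rightarrow> real" where
  "area_rot a b \<rho> = 2 * pi * integral {-\<rho>..\<rho>} (\<lambda>s. a s * b s)"

definition tot_scal_rot :: "(real \<Rightarrow> real) \<Rightarrow> (real \<Rightarrow> real) \<Rightarrow> real \<Rightarrow> real" where
  "tot_scal_rot a b \<rho> = 2 * pi * integral {-\<rho>..\<rho>} (\<lambda>s. scal_rot a b s * a s * b s)"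

definition smooth_fun :: "(real \<Rightarrow> real) \<Rightarrow> bool" where
  "smooth_fun f \<longleftrightarrow> (\<forall>n x. (deriv ^^ n) f differentiable (at x))"

text \<open>Evolving metric g(t) = e^(2 w(r,t)) g0, g0 = dr^2 + f(r)^2 dtheta^2.\<close>
definition flow_a :: "(real \<Rightarrow> real \<Rightarrow> real) \<Rightarrow> real \<Rightarrow> real \<Rightarrow> real" where
  "flow_a w t = (\<lambda>s. exp (w s t))"

definition flow_b :: "(real \<Rightarrow> real) \<Rightarrow> (real \<Rightarrow> real \<Rightarrow> real) \<Rightarrow> real \<Rightarrow> real \<Rightarrow> real" where
  "flow_b f w t = (\<lambda>s. exp (w s t) * f s)"

definition flow_R :: "(real \<Rightarrow> real) \<Rightarrow> (real \<Rightarrow> real \<Rightarrow> real) \<Rightarrow> real \<Rightarrow> real \<Rightarrow> real" where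
  "flow_R f w r t = scal_rot (flow_a w t) (flow_b f w t) r"

definition flow_r :: "(real \<Rightarrow> real) \<Rightarrow> real \<Rightarrow> (real \<Rightarrow> real \<Rightarrow> real) \<Rightarrow> real \<Rightarrow> real" where
  "flow_r f \<rho> w t = tot_scal_rot (flow_a w t) (flow_b f w t) \<rho>"

definition flow_phi :: "(real \<Rightarrow> real) \<Rightarrow> real \<Rightarrow> (real \<Rightarrow> real \<Rightarrow> real) \<Rightarrow> real \<Rightarrow> real" where
  "flow_phi f \<rho> w t = exp (integral {0..t} (flow_r f \<rho> w))"

text \<open>w describes a (rotationally symmetric, classical C^{2,1}) solution of the normalised flow
  dg/dt = (r - R) g,  k_g = k_{g0} / sqrt phi on the boundary,  g(0) = g0,  on M x [0, infinity).
  w(.,t) is given on all of R (a C^2 extension off [-rho,rho]); only its values on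
  [-rho,rho] enter the equations.\<close>
definition normalised_rot_flow ::
  "(real \<Rightarrow> real) \<Rightarrow> real \<Rightarrow> (real \<Rightarrow> real \<Rightarrow> real) \<Rightarrow> bool" where
  "normalised_rot_flow f \<rho> w \<longleftrightarrow>
     (\<forall>t\<ge>0. \<forall>x. (\<lambda>s. w s t) differentiable (at x)
                 \<and> deriv (\<lambda>s. w s t) differentiable (at x))
   \<and> continuous_on ({-\<rho>..\<rho>} \<times> {0..}) (\<lambda>(r, t). w r t)
   \<and> continuous_on ({-\<rho>..\<rho>} \<times> {0..}) (\<lambda>(r, t). deriv (\<lambda>s. w s t) r)
   \<and> continuous_on ({-\<rho>..\<rho>} \<times> {0..}) (\<lambda>(r, t). deriv (deriv (\<lambda>s. w s t)) r)
   \<and> (\<forall>r\<in>{-\<rho>..\<rho>}. w r 0 = 0)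
   \<and> (\<forall>r\<in>{-\<rho>..\<rho>}. \<forall>t\<ge>0.
        ((\<lambda>\<tau>. 2 * w r \<tau>) has_real_derivative (flow_r f \<rho> w t - flow_R f w r t)) (at t within {0..}))
   \<and> (\<forall>t\<ge>0. area_rot (flow_a w t) (flow_b f w t) \<rho> = 1)
   \<and> (\<forall>t\<ge>0. geod_curv_top (flow_a w t) (flow_b f w t) \<rho>
               = geod_curv_top (\<lambda>_. 1) f \<rho> / sqrt (flow_phi f \<rho> w t)
             \<and> geod_curv_bot (flow_a w t) (flow_b f w t) \<rho>
               = geod_curv_bot (\<lambda>_. 1) f \<rho> / sqrt (flow_phi f \<rho> w t))"

end

theory Submission
  imports Defs
begin

text \<open>After undoing the normalisation (V = w - (ln phi)/2, time s with ds = dt/phi) the flow is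
  V_s = e^(-2V) P_r / f  with  P = f V_r + f'  (this P is the derivative of V + ln f in the
  conformal coordinate dx = dr/f) and boundary condition P = f' e^V at r = rho and r = -rho, a
  condition with the right sign for comparison. Since R_{g_0} >= 0, the initial metric is a
  stationary supersolution, so V decreases in time; hence P_r <= 0 and P is bounded by its boundary
  values. An upper bound for the curvature amounts to a lower bound for P_r. As P need not be twice
  differentiable, the maximum principle is applied to the time increments W of J(r,t), the integral
  of 2P(r,.) over [0,t]: they satisfy a linear parabolic equation, W_r is the increment of e^(2V) f,
  and W_t has a sign on the boundary because V decreases. Comparing W(x) - W(y) with
  tau M (1 - e^(-Lambda (y - x))) bounds its slope by a constant times tau, uniformly in time;
  tau -> 0 gives the bound on P_r. Finally, a bound on P bounds the oscillation of w, so unit area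
  bounds w from below.\<close>

section \<open>Derivative tests at a maximum and first touching times\<close>

text \<open>A positive one-sided derivative would give a larger value just to the right.
  One-sidedness lets the maximum sit at an endpoint, as happens at the boundary circles and in the
  time variable.\<close>

lemma deriv_nonpos_at_max:
  fixes D :: "real \<Rightarrow> real"
  assumes "(D has_real_derivative l) (at c within {a..b})" "a \<le> c" "c < b"
    and "\<And>x. x \<in> {a..b} \<Longrightarrow> D x \<le> D c"
  shows "l \<le> 0"
proof (rule ccontr)
  assume "\<not> l \<le> 0"
  then obtain d where d: "d > 0" "\<And>h. h > 0 \<Longrightarrow> c + h \<in> {a..b} \<Longrightarrow> h < d \<Longrightarrow> D c < D (c + h)"
    using has_real_derivative_pos_inc_right[OF assms(1)] by force
  define h where "h = min (d/2) (b - c)"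
  have "h > 0" "h < d" "c + h \<in> {a..b}" using d(1) assms(2,3) by (auto simp: h_def min_def)
  then show False using d(2) assms(4) by fastforce
qed

lemma deriv_nonneg_at_max:
  fixes D :: "real \<Rightarrow> real"
  assumes "(D has_real_derivative l) (at c within {a..b})" "a < c" "c \<le> b"
    and "\<And>x. x \<in> {a..b} \<Longrightarrow> D x \<le> D c"
  shows "l \<ge> 0"
proof (rule ccontr)
  assume "\<not> l \<ge> 0"
  then obtain d where d: "d > 0" "\<And>h. h > 0 \<Longrightarrow> c - h \<in> {a..b} \<Longrightarrow> h < d \<Longrightarrow> D c < D (c - h)"
    using has_real_derivative_neg_dec_left[OF assms(1)] by force
  define h where "h = min (d/2) (c - a)"
  have "h > 0" "h < d" "c - h \<in> {a..b}" using d(1) assms(2,3) by (auto simp: h_def min_def)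
  then show False using d(2) assms(4) by fastforce
qed

text \<open>The equation \<open>D1 c = 0\<close> is a hypothesis so that \<open>c\<close> may be an
  endpoint, where maximality alone does not give it. If \<open>D2\<close> were positive,
  \<open>D1\<close> would be positive just right of \<open>c\<close> and negative just left of it,
  and the mean value theorem on an available side would give a value above
  \<open>D c\<close>.\<close>

lemma second_deriv_nonpos_at_max:
  fixes D :: "real \<Rightarrow> real"
  assumes D: "\<And>x. x \<in> {a..b} \<Longrightarrow> (D has_real_derivative D1 x) (at x)"
    and D1: "(D1 has_real_derivative D2) (at c)" and "D1 c = 0"
    and c: "c \<in> {a..b}" "a < b" and max: "\<And>x. x \<in> {a..b} \<Longrightarrow> D x \<le> D c"
  shows "D2 \<le> 0"
proof (rule ccontr)
  assume "\<not> D2 \<le> 0"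
  then have pos: "D2 > 0" by simp
  show False
  proof (cases "c < b")
    case True
    obtain d where d: "d > 0" "\<And>h. h > 0 \<Longrightarrow> h < d \<Longrightarrow> D1 c < D1 (c + h)"
      using DERIV_pos_inc_right[OF D1 pos] by auto
    define h where "h = min (d/2) (b - c)"
    have h: "h > 0" "h < d" "c + h \<le> b" using d(1) True by (auto simp: h_def min_def)
    obtain z where z: "c < z" "z < c + h" "D (c + h) - D c = h * D1 z"
      using MVT2[of c "c + h" D D1] D h c by fastforce
    have "D1 c < D1 (c + (z - c))" by (rule d(2)) (use z h in auto)
    then have "h * D1 z > 0" using h assms(3) by simp
    then show False using z max[of "c + h"] h c by auto
  next
    case False
    then have "a < c" using c by auto
    obtain d where d: "d > 0" "\<And>h. h > 0 \<Longrightarrow> h < d \<Longrightarrow> D1 (c - h) < D1 c"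
      using DERIV_pos_inc_left[OF D1 pos] by auto
    define h where "h = min (d/2) (c - a)"
    have h: "h > 0" "h < d" "a \<le> c - h" using d(1) \<open>a < c\<close> by (auto simp: h_def min_def)
    obtain z where z: "c - h < z" "z < c" "D c - D (c - h) = h * D1 z"
      using MVT2[of "c - h" c D D1] D h c by fastforce
    have "D1 (c - (c - z)) < D1 c" by (rule d(2)) (use z h in auto)
    then have "h * D1 z < 0" using h assms(3) by (simp add: mult_pos_neg)
    then show False using z max[of "c - h"] h c by auto
  qed
qed

text \<open>Skeleton of the maximum principle: the set where \<open>F\<close> is nonnegative is
  compact, so if nonempty it has a point of least time, and \<open>touch\<close> rules that point
  out. The space variable is abstract because it is a point in one application and a pair of points
  in another.\<close>

lemma negative_if_no_first_touching:
  fixes F :: "'a::metric_space \<Rightarrow> real \<Rightarrow> real"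
  assumes K: "compact K" and cont: "continuous_on (K \<times> {0..T}) (\<lambda>(z, t). F z t)"
    and init: "\<And>z. z \<in> K \<Longrightarrow> F z 0 < 0"
    and touch: "\<And>z t. z \<in> K \<Longrightarrow> 0 < t \<Longrightarrow> t \<le> T \<Longrightarrow> F z t = 0 \<Longrightarrow>
        (\<And>z' t'. z' \<in> K \<Longrightarrow> 0 \<le> t' \<Longrightarrow> t' \<le> t \<Longrightarrow> F z' t' \<le> 0) \<Longrightarrow> False"
    and z: "z \<in> K" "0 \<le> t" "t \<le> T"
  shows "F z t < 0"
proof (rule ccontr)
  assume "\<not> F z t < 0"
  let ?KT = "K \<times> {0..T}"
  define B where "B = ?KT \<inter> (\<lambda>(z, t). F z t) -` {0..}"
  have cKT: "compact ?KT" by (intro compact_Times K compact_Icc)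
  have clB: "closed B" unfolding B_def
    by (rule continuous_closed_preimage[OF cont compact_imp_closed[OF cKT]]) simp
  then have "compact B"
    using compact_Int_closed[OF cKT clB] by (simp add: B_def Int_absorb1 inf_assoc[symmetric])
  moreover have "(z, t) \<in> B" using \<open>\<not> F z t < 0\<close> z by (auto simp: B_def)
  then have "B \<noteq> {}" by blast
  ultimately obtain b where b: "b \<in> B" "\<And>b'. b' \<in> B \<Longrightarrow> snd b \<le> snd b'"
    using continuous_attains_inf[of B snd] continuous_on_snd[OF continuous_on_id] by blast
  obtain y s where ys: "b = (y, s)" by (cases b)
  have y: "y \<in> K" "0 \<le> s" "s \<le> T" "F y s \<ge> 0" using b ys by (auto simp: B_def)
  have s: "s > 0" using init[OF y(1)] y by (cases "s = 0") auto
  have before: "F z' t' < 0" if "z' \<in> K" "0 \<le> t'" "t' < s" for z' t'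
  proof -
    have "(z', t') \<notin> B" using b(2)[of "(z', t')"] that ys by auto
    then show ?thesis using that y by (auto simp: B_def)
  qed
  have upto: "F z' t' \<le> 0" if z': "z' \<in> K" "0 \<le> t'" "t' \<le> s" for z' t'
  proof (cases "t' < s")
    case True
    then show ?thesis using before z' by force
  next
    case False
    \<comment> \<open>At the touching time itself the inequality is the limit of the strict ones
      before it.\<close>
    have "continuous_on {0..s} (\<lambda>t. (\<lambda>(z, t). F z t) (z', t))"
      by (rule continuous_on_compose2[OF cont]) (use z' y in \<open>auto intro!: continuous_intros\<close>)
    then have "continuous_on {0..s} (F z')" by simp
    then have "continuous_on (closure {0..<s}) (F z')" using s by simp
    then have "F z' s \<le> 0"
      by (rule continuous_le_on_closure) (use before z' s in \<open>auto intro: less_imp_le\<close>)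
    then show ?thesis using False z' by auto
  qed
  show False by (rule touch[OF y(1) s y(3)]) (use upto y s in \<open>auto intro: antisym\<close>)
qed

section \<open>Change of the time variable\<close>

text \<open>Here \<open>s\<close> is the primitive of \<open>\<mu>\<close>, strictly increasing as
  \<open>\<mu>\<close> is positive, and \<open>g\<close> is its inverse. With \<open>\<mu>\<close>
  equal to 1/phi, \<open>s\<close> is unnormalised time as a function of normalised time.\<close>

lemma time_change:
  fixes \<mu> :: "real \<Rightarrow> real"
  assumes b: "b > 0" and cont: "continuous_on {0..b} \<mu>" and pos: "\<And>t. t \<in> {0..b} \<Longrightarrow> \<mu> t > 0"
  obtains s g where "s 0 = 0" "\<And>t. t \<in> {0..b} \<Longrightarrow> g (s t) = t"
    "\<And>t u. 0 \<le> t \<Longrightarrow> t < u \<Longrightarrow> u \<le> b \<Longrightarrow> s t < s u"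
    "\<And>x. x \<in> {0..s b} \<Longrightarrow> g x \<in> {0..b}" "\<And>x. x \<in> {0..s b} \<Longrightarrow> s (g x) = x"
    "continuous_on {0..s b} g"
    "\<And>x. 0 < x \<Longrightarrow> x < s b \<Longrightarrow> (g has_real_derivative 1 / \<mu> (g x)) (at x)"
proof -
  define s where "s = (\<lambda>x. integral {0..x} \<mu>)"
  have der: "(s has_real_derivative \<mu> t) (at t within {0..b})" if "t \<in> {0..b}" for t
    unfolding s_def by (rule integral_has_real_derivative[OF cont that])
  then have contS: "continuous_on {0..b} s"
    by (meson DERIV_continuous continuous_on_eq_continuous_within)
  have derI: "(s has_real_derivative \<mu> t) (at t)" if "0 < t" "t < b" for t
    using der[of t] that at_within_Icc_at[of 0 t b] by auto
  have mono: "s t < s u" if "0 \<le> t" "t < u" "u \<le> b" for t u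
  proof (rule DERIV_pos_imp_increasing_open[OF that(2)])
    show "continuous_on {t..u} s" by (rule continuous_on_subset[OF contS]) (use that in auto)
    show "\<exists>y. (s has_real_derivative y) (at x) \<and> y > 0" if "t < x" "x < u" for x
      using derI[of x] pos[of x] that \<open>0 \<le> t\<close> \<open>u \<le> b\<close> by auto
  qed
  have inj: "inj_on s {0..b}"
    by (rule linorder_inj_onI) (use mono in \<open>fastforce+\<close>)
  have s0: "s 0 = 0" by (simp add: s_def)
  have img: "s ` {0..b} = {0..s b}"
  proof
    show "s ` {0..b} \<subseteq> {0..s b}"
    proof clarify
      fix t assume "t \<in> {0..b}"
      then show "s t \<in> {0..s b}" using mono[of 0 t] mono[of t b] s0
        by (cases "t = 0"; cases "t = b") (use b mono[of 0 b] in auto)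
    qed
    show "{0..s b} \<subseteq> s ` {0..b}"
      using IVT'[of s 0 _ b] s0 contS b by (fastforce simp: image_iff)
  qed
  define g where "g = the_inv_into {0..b} s"
  have gs: "g (s t) = t" if "t \<in> {0..b}" for t
    using the_inv_into_f_f[OF inj that] by (simp add: g_def)
  have sg: "s (g x) = x" "g x \<in> {0..b}" if "x \<in> {0..s b}" for x
    using f_the_inv_into_f[OF inj] the_inv_into_into[OF inj _ subset_refl] that img
    by (auto simp: g_def)
  have contg: "continuous_on {0..s b} g"
    using continuous_on_inv_into[OF contS compact_Icc inj] img by (simp add: g_def)
  have derg: "(g has_real_derivative 1 / \<mu> (g x)) (at x)" if x: "0 < x" "x < s b" for x
  proof -
    have gx: "g x \<in> {0..b}" using sg x by auto
    have "g x \<noteq> 0" "g x \<noteq> b" using sg(1)[of x] x s0 by auto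
    then have gx': "0 < g x" "g x < b" using gx by auto
    have "isCont g x" using continuous_on_interior[OF contg] x by auto
    then have "(g has_real_derivative inverse (\<mu> (g x))) (at x)"
      by (intro DERIV_inverse_function[where f = s and a = 0 and b = "s b"])
        (use derI[OF gx'] pos[OF gx] x sg in auto)
    then show ?thesis by (simp add: inverse_eq_divide)
  qed
  show thesis by (rule that[of s g]) (use s0 gs mono sg contg derg in auto)
qed

section \<open>Comparison principle for the unnormalised flow\<close>

text \<open>\<open>A\<close> is a solution and \<open>B\<close> a supersolution with the same
  nonlinear boundary condition. At a first touching of \<open>A\<close> with \<open>B\<close> plus a
  small growing barrier, the signs of \<open>f1\<close> at the two ends exclude a boundary slope, so
  the second-order test applies there too; the growth of the barrier pays for the change in the
  factor \<open>exp (-2 * A r t)\<close>.\<close>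

lemma comparison:
  fixes A A1 A2 B B1 B2 Bt :: "real \<Rightarrow> real \<Rightarrow> real" and f f1 f2 :: "real \<Rightarrow> real"
  assumes \<rho>: "\<rho> > 0" and f: "\<And>r. r \<in> {-\<rho>..\<rho>} \<Longrightarrow> f r > 0" and f1: "f1 \<rho> \<le> 0" "f1 (-\<rho>) \<ge> 0"
    and contA: "continuous_on ({-\<rho>..\<rho>} \<times> {0..T}) (\<lambda>(r, t). A r t)"
    and contB: "continuous_on ({-\<rho>..\<rho>} \<times> {0..T}) (\<lambda>(r, t). B r t)"
    and A: "\<And>r t. r \<in> {-\<rho>..\<rho>} \<Longrightarrow> 0 < t \<Longrightarrow> t \<le> T \<Longrightarrow> ((\<lambda>r. A r t) has_real_derivative A1 r t) (at r)"
    and A1: "\<And>r t. r \<in> {-\<rho>..\<rho>} \<Longrightarrow> 0 < t \<Longrightarrow> t \<le> T \<Longrightarrow> ((\<lambda>r. A1 r t) has_real_derivative A2 r t) (at r)"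
    and B: "\<And>r t. r \<in> {-\<rho>..\<rho>} \<Longrightarrow> 0 < t \<Longrightarrow> t \<le> T \<Longrightarrow> ((\<lambda>r. B r t) has_real_derivative B1 r t) (at r)"
    and B1: "\<And>r t. r \<in> {-\<rho>..\<rho>} \<Longrightarrow> 0 < t \<Longrightarrow> t \<le> T \<Longrightarrow> ((\<lambda>r. B1 r t) has_real_derivative B2 r t) (at r)"
    and At: "\<And>r t. r \<in> {-\<rho>..\<rho>} \<Longrightarrow> 0 < t \<Longrightarrow> t \<le> T \<Longrightarrow>
        (A r has_real_derivative exp (-2 * A r t) * (f r * A2 r t + f1 r * A1 r t + f2 r) / f r) (at t)"
    and Bt: "\<And>r t. r \<in> {-\<rho>..\<rho>} \<Longrightarrow> 0 < t \<Longrightarrow> t \<le> T \<Longrightarrow> (B r has_real_derivative Bt r t) (at t)"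
    and super: "\<And>r t. r \<in> {-\<rho>..\<rho>} \<Longrightarrow> 0 < t \<Longrightarrow> t \<le> T \<Longrightarrow>
        exp (-2 * B r t) * (f r * B2 r t + f1 r * B1 r t + f2 r) / f r \<le> Bt r t"
    and bound: "\<And>r t. r \<in> {-\<rho>..\<rho>} \<Longrightarrow> 0 < t \<Longrightarrow> t \<le> T \<Longrightarrow>
        \<bar>exp (-2 * B r t) * (f r * B2 r t + f1 r * B1 r t + f2 r) / f r\<bar> \<le> K"
    and bcA: "\<And>r t. r \<in> {-\<rho>, \<rho>} \<Longrightarrow> 0 < t \<Longrightarrow> t \<le> T \<Longrightarrow> f r * A1 r t + f1 r = f1 r * exp (A r t)"
    and bcB: "\<And>r t. r \<in> {-\<rho>, \<rho>} \<Longrightarrow> 0 < t \<Longrightarrow> t \<le> T \<Longrightarrow> f r * B1 r t + f1 r = f1 r * exp (B r t)"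
    and init: "\<And>r. r \<in> {-\<rho>..\<rho>} \<Longrightarrow> A r 0 \<le> B r 0"
    and r: "r \<in> {-\<rho>..\<rho>}" "0 \<le> t" "t \<le> T"
  shows "A r t \<le> B r t"
proof (rule field_le_epsilon)
  fix e :: real assume "e > 0"
  \<comment> \<open>Replacing \<open>A\<close> by \<open>B\<close> in the exponential costs at most
    \<open>2 * \<bar>K\<bar>\<close> times the barrier; the extra 1 makes the final inequality
    strict. Below, \<open>\<epsilon>\<close> is scaled so that the barrier stays at most
    \<open>e\<close> up to time \<open>T\<close>.\<close>
  define L where "L = 2 * \<bar>K\<bar> + 1"
  define \<epsilon> where "\<epsilon> = e * exp (- L * T)"
  have \<epsilon>: "\<epsilon> > 0" using \<open>e > 0\<close> by (simp add: \<epsilon>_def)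
  define F where "F = (\<lambda>r t. A r t - B r t - \<epsilon> * exp (L * t))"
  have "F r t < 0"
  proof (rule negative_if_no_first_touching[of "{-\<rho>..\<rho>}" T F])
    show "continuous_on ({-\<rho>..\<rho>} \<times> {0..T}) (\<lambda>(r, t). F r t)"
      using contA contB by (auto simp: F_def case_prod_unfold intro!: continuous_intros)
    show "F r 0 < 0" if "r \<in> {-\<rho>..\<rho>}" for r
      using init[OF that] \<epsilon> by (simp add: F_def)
    fix r t
    assume r: "r \<in> {-\<rho>..\<rho>}" and t: "0 < t" "t \<le> T" and zero: "F r t = 0"
      and le: "\<And>r' t'. r' \<in> {-\<rho>..\<rho>} \<Longrightarrow> 0 \<le> t' \<Longrightarrow> t' \<le> t \<Longrightarrow> F r' t' \<le> 0"
    define \<eta> where "\<eta> = \<epsilon> * exp (L * t)"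
    have \<eta>: "\<eta> > 0" "A r t = B r t + \<eta>" using \<epsilon> zero by (auto simp: \<eta>_def F_def)
    define D where "D = (\<lambda>x. F x t)"
    define D1 where "D1 = (\<lambda>x. A1 x t - B1 x t)"
    define D2 where "D2 = A2 r t - B2 r t"
    have D: "(D has_real_derivative D1 x) (at x)" if "x \<in> {-\<rho>..\<rho>}" for x
      unfolding D_def D1_def F_def using A[OF that t] B[OF that t] by (auto intro!: derivative_eq_intros)
    have D1: "(D1 has_real_derivative D2) (at r)"
      unfolding D2_def D1_def using A1[OF r t] B1[OF r t] by (auto intro!: derivative_eq_intros)
    have max: "D x \<le> D r" if "x \<in> {-\<rho>..\<rho>}" for x
      using le[OF that] t zero by (auto simp: D_def)
    have Dr: "(D has_real_derivative D1 r) (at r within {-\<rho>..\<rho>})"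
      using D[OF r] by (rule has_field_derivative_at_within)
    have le0: "r < \<rho> \<Longrightarrow> D1 r \<le> 0" and ge0: "-\<rho> < r \<Longrightarrow> D1 r \<ge> 0"
      using deriv_nonpos_at_max[OF Dr _ _ max] deriv_nonneg_at_max[OF Dr _ _ max] r by auto
    have exps: "exp (A r t) - exp (B r t) \<ge> 0" using \<eta> by simp
    \<comment> \<open>At an end, maximality gives one sign of \<open>D1 r\<close>, and the
      difference of the boundary conditions gives the other, since \<open>exp (A r t)\<close>
      exceeds \<open>exp (B r t)\<close>.\<close>
    have "D1 r = 0"
    proof -
      have "f r * D1 r = f1 r * (exp (A r t) - exp (B r t))" if "r \<in> {-\<rho>, \<rho>}"
        using bcA[OF that t] bcB[OF that t] by (simp add: D1_def algebra_simps)
      then have "r = \<rho> \<Longrightarrow> f r * D1 r \<le> 0" "r = -\<rho> \<Longrightarrow> f r * D1 r \<ge> 0"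
        using f1 exps by (auto simp: mult_nonpos_nonneg)
      then have "r = \<rho> \<Longrightarrow> D1 r \<le> 0" "r = -\<rho> \<Longrightarrow> D1 r \<ge> 0"
        using f[OF r] by (auto simp: mult_le_0_iff zero_le_mult_iff)
      then show ?thesis using le0 ge0 r by fastforce
    qed
    have "D2 \<le> 0"
      by (rule second_deriv_nonpos_at_max[OF D D1 \<open>D1 r = 0\<close> r _ max]) (use \<rho> in auto)
    define PA where "PA = f r * A2 r t + f1 r * A1 r t + f2 r"
    define PB where "PB = f r * B2 r t + f1 r * B1 r t + f2 r"
    have "PA - PB = f r * D2 + f1 r * D1 r" by (simp add: PA_def PB_def D2_def D1_def algebra_simps)
    then have PAB: "PA \<le> PB" using \<open>D1 r = 0\<close> \<open>D2 \<le> 0\<close> f[OF r] mult_nonneg_nonpos[of "f r" D2] by simp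
    define G where "G = exp (-2 * B r t) * PB / f r"
    have G: "\<bar>G\<bar> \<le> K" "G \<le> Bt r t" using bound[OF r t] super[OF r t] by (auto simp: G_def PB_def)
    have "exp (-2 * A r t) * PA / f r \<le> exp (-2 * A r t) * PB / f r"
      using PAB f[OF r] by (simp add: divide_right_mono)
    also have "\<dots> = exp (-2 * \<eta>) * G"
      by (simp add: G_def \<eta>(2) exp_add[symmetric] algebra_simps)
    finally have 1: "exp (-2 * A r t) * PA / f r \<le> exp (-2 * \<eta>) * G" .
    \<comment> \<open>\<open>G\<close> may be negative, and then the factor
      \<open>exp (-2 * \<eta>)\<close> raises it, but by at most \<open>2 * \<eta>\<close> times its
      size.\<close>
    have "exp (-2 * \<eta>) \<ge> 1 + (-2 * \<eta>)" by (rule exp_ge_add_one_self)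
    then have "(1 - exp (-2 * \<eta>)) * - G \<le> (2 * \<eta>) * \<bar>K\<bar>"
      using mult_left_mono[of "- G" "\<bar>K\<bar>" "1 - exp (-2 * \<eta>)"] G(1)
        mult_right_mono[of "1 - exp (-2 * \<eta>)" "2 * \<eta>" "\<bar>K\<bar>"] \<eta>(1) by (smt (verit) one_le_exp_iff)
    then have 2: "exp (-2 * \<eta>) * G - G \<le> 2 * \<bar>K\<bar> * \<eta>" by (simp add: algebra_simps)
    have "(F r has_real_derivative (exp (-2 * A r t) * PA / f r - Bt r t - L * \<eta>)) (at t)"
      unfolding F_def using At[OF r t] Bt[OF r t]
      by (auto intro!: derivative_eq_intros simp: PA_def \<eta>_def)
    then have "(F r has_real_derivative (exp (-2 * A r t) * PA / f r - Bt r t - L * \<eta>)) (at t within {0..t})"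
      by (rule has_field_derivative_at_within)
    then have "exp (-2 * A r t) * PA / f r - Bt r t - L * \<eta> \<ge> 0"
      by (rule deriv_nonneg_at_max) (use t zero le[OF r] in auto)
    moreover have "L * \<eta> = 2 * \<bar>K\<bar> * \<eta> + \<eta>" by (simp add: L_def algebra_simps)
    ultimately show False using 1 2 G \<eta> by linarith
  qed (use r in auto)
  moreover have "\<epsilon> * exp (L * t) \<le> e"
  proof -
    have "L * t \<le> L * T" using r by (intro mult_left_mono) (auto simp: L_def)
    then have "exp (- L * T) * exp (L * t) \<le> 1" by (simp add: exp_add[symmetric])
    then show ?thesis using \<open>e > 0\<close> by (simp add: \<epsilon>_def)
  qed
  ultimately show "A r t \<le> B r t + e" by (simp add: F_def)
qed


section \<open>The unnormalised flow: monotonicity in time and the first-order bound\<close>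

text \<open>The metric is e^(2V) g0. The sign of \<open>f2\<close> expresses nonnegative initial
  scalar curvature, and the signs of \<open>f1\<close> at the ends express nonpositive geodesic
  curvature. The evolution equation is available at interior times only, so later comparisons stop
  strictly before \<open>T\<close>.\<close>

locale rotational_flow =
  fixes f f1 f2 :: "real \<Rightarrow> real" and V V1 V2 :: "real \<Rightarrow> real \<Rightarrow> real" and \<rho> T :: real
  assumes \<rho>: "\<rho> > 0" and T: "T > 0"
    and f: "\<And>r. r \<in> {-\<rho>..\<rho>} \<Longrightarrow> f r > 0" "\<And>r. (f has_real_derivative f1 r) (at r)"
    and f1: "\<And>r. (f1 has_real_derivative f2 r) (at r)" "f1 \<rho> \<le> 0" "f1 (-\<rho>) \<ge> 0"
    and f2: "\<And>r. r \<in> {-\<rho>..\<rho>} \<Longrightarrow> f2 r \<le> 0" "continuous_on {-\<rho>..\<rho>} f2"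
    and V: "\<And>r t. 0 \<le> t \<Longrightarrow> t \<le> T \<Longrightarrow> ((\<lambda>r. V r t) has_real_derivative V1 r t) (at r)"
    and V1: "\<And>r t. 0 \<le> t \<Longrightarrow> t \<le> T \<Longrightarrow> ((\<lambda>r. V1 r t) has_real_derivative V2 r t) (at r)"
    and contV: "continuous_on ({-\<rho>..\<rho>} \<times> {0..T}) (\<lambda>(r, t). V r t)"
    and contV1: "continuous_on ({-\<rho>..\<rho>} \<times> {0..T}) (\<lambda>(r, t). V1 r t)"
    and contV2: "continuous_on ({-\<rho>..\<rho>} \<times> {0..T}) (\<lambda>(r, t). V2 r t)"
    and evol: "\<And>r t. r \<in> {-\<rho>..\<rho>} \<Longrightarrow> 0 < t \<Longrightarrow> t < T \<Longrightarrow>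
        (V r has_real_derivative exp (-2 * V r t) * (f r * V2 r t + f1 r * V1 r t + f2 r) / f r) (at t)"
    and bc: "\<And>r t. r \<in> {-\<rho>, \<rho>} \<Longrightarrow> 0 \<le> t \<Longrightarrow> t \<le> T \<Longrightarrow> f r * V1 r t + f1 r = f1 r * exp (V r t)"
    and init: "\<And>r. r \<in> {-\<rho>..\<rho>} \<Longrightarrow> V r 0 = 0"
begin

definition P where "P r t = f r * V1 r t + f1 r"
text \<open>The scalar curvature of e^(2V) g0 is -2 e^(-2V) \<open>P'\<close> / f.\<close>

definition P' where "P' r t = f r * V2 r t + f1 r * V1 r t + f2 r"

lemma P_deriv: "0 \<le> t \<Longrightarrow> t \<le> T \<Longrightarrow> ((\<lambda>r. P r t) has_real_derivative P' r t) (at r)"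
  unfolding P_def P'_def by (auto intro!: derivative_eq_intros V V1 f f1)

lemma cont_f: "continuous_on A f" and cont_f1: "continuous_on A f1"
  using f(2) f1(1) by (meson DERIV_continuous continuous_at_imp_continuous_on)+

lemma cont_P: "continuous_on ({-\<rho>..\<rho>} \<times> {0..T}) (\<lambda>(r, t). P r t)"
  and cont_P': "continuous_on ({-\<rho>..\<rho>} \<times> {0..T}) (\<lambda>(r, t). P' r t)"
  unfolding P_def P'_def case_prod_unfold
  using contV1 contV2 f2(2)
  by (auto simp: case_prod_unfold
      intro!: continuous_intros continuous_on_compose2[OF cont_f[of UNIV]] continuous_on_compose2[OF cont_f1[of UNIV]]
              continuous_on_compose2[OF f2(2)])

lemma cont_time:
  assumes "continuous_on ({-\<rho>..\<rho>} \<times> {0..T}) (\<lambda>(r, t). G r t)" "r \<in> {-\<rho>..\<rho>}"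
  shows "continuous_on {0..T} (G r)"
proof -
  have "continuous_on {0..T} (\<lambda>t. (\<lambda>(r, t). G r t) (r, t))"
    by (rule continuous_on_compose2[OF assms(1)]) (use assms(2) in \<open>auto intro!: continuous_intros\<close>)
  then show ?thesis by simp
qed

lemma bounded_jointly:
  fixes G :: "real \<Rightarrow> real \<Rightarrow> real"
  assumes "continuous_on ({-\<rho>..\<rho>} \<times> {0..T}) (\<lambda>(r, t). G r t)"
  obtains K where "\<And>r t. r \<in> {-\<rho>..\<rho>} \<Longrightarrow> 0 \<le> t \<Longrightarrow> t \<le> T \<Longrightarrow> \<bar>G r t\<bar> \<le> K"
proof -
  have "bounded ((\<lambda>(r, t). G r t) ` ({-\<rho>..\<rho>} \<times> {0..T}))"
    by (intro compact_imp_bounded compact_continuous_image assms compact_Times compact_Icc)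
  then show thesis using that by (force simp: bounded_iff)
qed

lemma evolution_bounded:
  obtains K where "\<And>r t. r \<in> {-\<rho>..\<rho>} \<Longrightarrow> 0 \<le> t \<Longrightarrow> t \<le> T \<Longrightarrow> \<bar>exp (-2 * V r t) * P' r t / f r\<bar> \<le> K"
proof (rule bounded_jointly)
  have "continuous_on ({-\<rho>..\<rho>} \<times> {0..T}) (\<lambda>x. f (fst x))"
    by (intro continuous_on_compose2[OF cont_f[of UNIV]] continuous_intros) auto
  then show "continuous_on ({-\<rho>..\<rho>} \<times> {0..T}) (\<lambda>(r, t). exp (-2 * V r t) * P' r t / f r)"
    using contV cont_P' f(1) by (fastforce simp: case_prod_unfold intro!: continuous_intros)
qed (rule that)

text \<open>The zero function satisfies the boundary condition exactly and is a supersolution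
  because \<open>f2\<close> is nonpositive.\<close>

lemma V_nonpos:
  assumes r: "r \<in> {-\<rho>..\<rho>}" and t: "0 \<le> t" "t < T"
  shows "V r t \<le> 0"
proof -
  have "continuous_on {-\<rho>..\<rho>} (\<lambda>r. f2 r / f r)"
    using f(1) f2(2) by (intro continuous_intros cont_f) force+
  then have "bounded ((\<lambda>r. f2 r / f r) ` {-\<rho>..\<rho>})"
    by (intro compact_imp_bounded compact_continuous_image compact_Icc)
  then obtain K where K: "\<And>r. r \<in> {-\<rho>..\<rho>} \<Longrightarrow> \<bar>f2 r / f r\<bar> \<le> K" by (force simp: bounded_iff)
  show ?thesis
  proof (rule comparison[OF \<rho> f(1) f1(2,3), where A = V and ?A1.0 = V1 and ?A2.0 = V2 and T = t
        and ?f2.0 = f2 and B = "\<lambda>_ _. 0" and ?B1.0 = "\<lambda>_ _. 0" and ?B2.0 = "\<lambda>_ _. 0"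
        and Bt = "\<lambda>_ _. 0" and K = K])
    show "continuous_on ({-\<rho>..\<rho>} \<times> {0..t}) (\<lambda>(r, t). V r t)"
      by (rule continuous_on_subset[OF contV]) (use t in auto)
  qed (use r t K V V1 evol bc init f f2 in \<open>auto simp: divide_nonpos_pos\<close>)
qed

text \<open>The flow shifted by \<open>h\<close> is again a solution, and by \<open>V_nonpos\<close>
  it starts below the original one.\<close>

lemma V_antimono:
  assumes r: "r \<in> {-\<rho>..\<rho>}" and t: "0 \<le> t" "0 \<le> h" "t + h < T"
  shows "V r (t + h) \<le> V r t"
proof -
  obtain K where K: "\<And>r t. r \<in> {-\<rho>..\<rho>} \<Longrightarrow> 0 \<le> t \<Longrightarrow> t \<le> T \<Longrightarrow> \<bar>exp (-2 * V r t) * P' r t / f r\<bar> \<le> K"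
    by (rule evolution_bounded) blast
  show ?thesis
  proof (rule comparison[OF \<rho> f(1) f1(2,3), where A = "\<lambda>r t. V r (t + h)" and ?A1.0 = "\<lambda>r t. V1 r (t + h)"
        and ?A2.0 = "\<lambda>r t. V2 r (t + h)" and T = t and ?f2.0 = f2 and B = V and ?B1.0 = V1 and ?B2.0 = V2
        and Bt = "\<lambda>r t. exp (-2 * V r t) * P' r t / f r" and K = K])
    show "continuous_on ({-\<rho>..\<rho>} \<times> {0..t}) (\<lambda>(r, t). V r t)"
      by (rule continuous_on_subset[OF contV]) (use t in auto)
    have "continuous_on ({-\<rho>..\<rho>} \<times> {0..t}) (\<lambda>x. (\<lambda>(r, t). V r t) (fst x, snd x + h))"
      by (rule continuous_on_compose2[OF contV]) (use t in \<open>auto intro!: continuous_intros\<close>)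
    then show "continuous_on ({-\<rho>..\<rho>} \<times> {0..t}) (\<lambda>(r, t). V r (t + h))"
      by (simp add: case_prod_unfold)
    fix r s assume r: "r \<in> {-\<rho>..\<rho>}" and s: "0 < s" "s \<le> t"
    show "((\<lambda>s. V r (s + h)) has_real_derivative
        exp (-2 * V r (s + h)) * (f r * V2 r (s + h) + f1 r * V1 r (s + h) + f2 r) / f r) (at s)"
      using evol[OF r, of "s + h"] s t by (simp add: DERIV_shift)
    show "(V r has_real_derivative exp (-2 * V r s) * P' r s / f r) (at s)"
      using evol[OF r, of s] s t by (simp add: P'_def)
    show "\<bar>exp (-2 * V r s) * (f r * V2 r s + f1 r * V1 r s + f2 r) / f r\<bar> \<le> K"
      using K[OF r, of s] s t by (simp add: P'_def)
  qed (use r t V V1 bc init f V_nonpos in \<open>auto simp: P'_def\<close>)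
qed

lemma P'_nonpos:
  assumes r: "r \<in> {-\<rho>..\<rho>}" and t: "0 \<le> t" "t \<le> T"
  shows "P' r t \<le> 0"
proof -
  have "P' r t \<le> 0" if t: "0 < t" "t < T" for t
  proof -
    define G where "G = exp (-2 * V r t) * P' r t / f r"
    \<comment> \<open>The interval ends halfway to \<open>T\<close>, so that
      \<open>V_antimono\<close> applies throughout and \<open>t\<close> is a maximum on it.\<close>
    have "(V r has_real_derivative G) (at t within {t..(t + T) / 2})"
      using evol[OF r t] by (auto simp: P'_def G_def intro: has_field_derivative_at_within)
    then have "G \<le> 0"
      by (rule deriv_nonpos_at_max) (use t V_antimono[OF r, of t "_ - t"] in \<open>auto simp: field_simps\<close>)
    then show ?thesis using f(1)[OF r] by (simp add: G_def divide_le_0_iff mult_le_0_iff)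
  qed
  moreover have "continuous_on (closure {0<..<T}) (P' r)" using cont_time[OF cont_P' r] T by simp
  ultimately show ?thesis
    using continuous_le_on_closure[of "{0<..<T}" "P' r" t 0] t T by auto
qed

definition slope_bound where "slope_bound = max (f1 (-\<rho>)) (- f1 \<rho>)"

text \<open>By \<open>P'_nonpos\<close>, \<open>P\<close> decreases in \<open>r\<close>, so it lies
  between its end values \<open>f1 r * exp (V r t)\<close>, where the exponential is at most
  1.\<close>

lemma P_bound:
  assumes r: "r \<in> {-\<rho>..\<rho>}" and t: "0 \<le> t" "t < T"
  shows "\<bar>P r t\<bar> \<le> slope_bound"
proof -
  have dec: "P y t \<le> P x t" if "-\<rho> \<le> x" "x \<le> y" "y \<le> \<rho>" for x y
    by (rule DERIV_nonpos_imp_nonincreasing[OF that(2)])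
      (use P_deriv[of t] P'_nonpos[of _ t] t that in fastforce)
  have e: "exp (V x t) \<le> 1" if "x \<in> {-\<rho>..\<rho>}" for x using V_nonpos[OF that t] by simp
  have "P (-\<rho>) t \<le> f1 (-\<rho>)"
    using bc[of "-\<rho>" t] t mult_left_mono[OF e[of "-\<rho>"] f1(3)] \<rho> by (simp add: P_def)
  moreover have "P \<rho> t \<ge> f1 \<rho>"
    using bc[of "\<rho>" t] t mult_left_mono_neg[OF e[of \<rho>] f1(2)] \<rho> by (simp add: P_def)
  ultimately show ?thesis using dec[of "-\<rho>" r] dec[of r \<rho>] r by (auto simp: slope_bound_def)
qed

section \<open>Time increments of a potential and the two-point estimate\<close>

text \<open>\<open>m\<close> is the area density of e^(2V) g0. Its time derivative is the space
  derivative of \<open>2 * P\<close>, so \<open>J\<close> is a potential with J_t = 2P and J_r =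
  m(t) - m(0). It has two space derivatives where \<open>P\<close> has one.\<close>

definition m where "m r t = exp (2 * V r t) * f r"
definition J where "J r x = integral {0..x} (\<lambda>s. 2 * P r s)"

lemma J_deriv_time:
  assumes r: "r \<in> {-\<rho>..\<rho>}" and x: "0 < x" "x < T"
  shows "(J r has_real_derivative 2 * P r x) (at x)"
proof -
  have "(J r has_real_derivative 2 * P r x) (at x within {0..T})"
    unfolding J_def[abs_def]
    by (rule integral_has_real_derivative) (use x cont_time[OF cont_P r] in \<open>auto intro!: continuous_intros\<close>)
  then show ?thesis using x at_within_Icc_at[of 0 x T] by simp
qed

lemma m_deriv_space:
  "0 \<le> t \<Longrightarrow> t \<le> T \<Longrightarrow> r \<in> {-\<rho>..\<rho>} \<Longrightarrow>
    ((\<lambda>r. m r t) has_real_derivative exp (2 * V r t) * (2 * P r t - f1 r)) (at r)"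
  unfolding m_def P_def by (auto intro!: derivative_eq_intros V f simp: algebra_simps)

text \<open>This is the evolution of the area form, d/dt dA = -R dA.\<close>

lemma m_deriv_time:
  assumes r: "r \<in> {-\<rho>..\<rho>}" and t: "0 < t" "t < T"
  shows "(m r has_real_derivative 2 * P' r t) (at t)"
proof -
  define G where "G = exp (-2 * V r t) * P' r t / f r"
  have "(V r has_real_derivative G) (at t)" using evol[OF r t] by (simp add: G_def P'_def)
  then have "(m r has_real_derivative exp (2 * V r t) * (2 * G) * f r) (at t)"
    unfolding m_def[abs_def] by (auto intro!: derivative_eq_intros)
  moreover have "exp (2 * V r t) * exp (-2 * V r t) = 1" by (simp add: exp_add[symmetric])
  then have "exp (2 * V r t) * (2 * G) * f r = 2 * P' r t"
    using f(1)[OF r] by (simp add: G_def)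
  ultimately show ?thesis by simp
qed

text \<open>Differentiation under the integral produces the integral of \<open>2 * P'\<close>, which
  \<open>m_deriv_time\<close> identifies as an increment of \<open>m\<close>.\<close>

lemma J_deriv_space:
  assumes r: "r \<in> {-\<rho>..\<rho>}" and x: "0 \<le> x" "x \<le> T"
  shows "((\<lambda>r. J r x) has_real_derivative m r x - m r 0) (at r within {-\<rho>..\<rho>})"
proof -
  have "((\<lambda>r. integral (cbox 0 x) (\<lambda>s. 2 * P r s)) has_real_derivative integral (cbox 0 x) (\<lambda>s. 2 * P' r s))
      (at r within {-\<rho>..\<rho>})"
  proof (rule leibniz_rule_field_derivative)
    fix y s assume "y \<in> {-\<rho>..\<rho>}" "s \<in> cbox 0 x"
    then show "((\<lambda>y. 2 * P y s) has_real_derivative 2 * P' y s) (at y within {-\<rho>..\<rho>})"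
      using has_field_derivative_at_within[OF DERIV_cmult[OF P_deriv[of s y], of 2]] x by auto
  next
    fix y assume y: "y \<in> {-\<rho>..\<rho>}"
    have "continuous_on {0..x} (P y)"
      by (rule continuous_on_subset[OF cont_time[OF cont_P y]]) (use x in auto)
    then show "(\<lambda>s. 2 * P y s) integrable_on cbox 0 x"
      by (intro integrable_continuous continuous_intros) auto
  next
    have "continuous_on ({-\<rho>..\<rho>} \<times> cbox 0 x) (\<lambda>(y, s). P' y s)"
      by (rule continuous_on_subset[OF cont_P']) (use x in auto)
    then show "continuous_on ({-\<rho>..\<rho>} \<times> cbox 0 x) (\<lambda>(y, s). 2 * P' y s)"
      by (auto simp: case_prod_unfold intro!: continuous_intros)
  qed (use r in auto)
  moreover have "((\<lambda>s. 2 * P' r s) has_integral m r x - m r 0) {0..x}"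
  proof (rule fundamental_theorem_of_calculus_interior[OF x(1)])
    show "continuous_on {0..x} (m r)"
      unfolding m_def[abs_def] using x
      by (intro continuous_intros continuous_on_subset[OF cont_time[OF contV r]]) auto
    show "(m r has_vector_derivative 2 * P' r s) (at s)" if "s \<in> {0<..<x}" for s
      using m_deriv_time[OF r, of s] that x by (simp add: has_real_derivative_iff_has_vector_derivative)
  qed
  then have "integral (cbox 0 x) (\<lambda>s. 2 * P' r s) = m r x - m r 0"
    by (simp only: integral_unique cbox_interval)
  ultimately show ?thesis unfolding J_def by (simp only: cbox_interval)
qed

text \<open>Continuity in \<open>r\<close> at each fixed time becomes joint continuity because
  \<open>J\<close> is Lipschitz in time with one constant for all \<open>r\<close>.\<close>

lemma cont_J: "continuous_on ({-\<rho>..\<rho>} \<times> {0..T}) (\<lambda>(r, t). J r t)"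
proof (rule continuous_on_TimesI)
  show "continuous_on {-\<rho>..\<rho>} (\<lambda>r. J r t)" if "t \<in> {0..T}" for t
    unfolding continuous_on_eq_continuous_within
    by (intro ballI DERIV_continuous[OF J_deriv_space]) (use that in auto)
  obtain K where K: "\<And>r t. r \<in> {-\<rho>..\<rho>} \<Longrightarrow> 0 \<le> t \<Longrightarrow> t \<le> T \<Longrightarrow> \<bar>P r t\<bar> \<le> K"
    using bounded_jointly[OF cont_P] by blast
  have "(2 * K)-lipschitz_on {0..T} (J r)" if r: "r \<in> {-\<rho>..\<rho>}" for r
  proof (rule bounded_derivative_imp_lipschitz)
    show "(J r has_derivative (\<lambda>h. 2 * P r x * h)) (at x within {0..T})" if "x \<in> {0..T}" for x
      using integral_has_real_derivative[OF _ that, of "\<lambda>s. 2 * P r s"] cont_time[OF cont_P r]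
      unfolding J_def[abs_def] by (simp add: has_field_derivative_def continuous_on_mult_left)
    show "onorm (\<lambda>h. 2 * P r x * h) \<le> 2 * K" if "x \<in> {0..T}" for x
      using K[OF r, of x] that by (intro onorm_le) (auto simp: abs_mult intro!: mult_right_mono)
    show "0 \<le> 2 * K" using K[OF r, of 0] T by auto
  qed simp
  then show "local_lipschitz {-\<rho>..\<rho>} {0..T} J"
    by (intro local_lipschitzI exI[of _ 1] exI[of _ "2 * K"] conjI ballI)
      (auto intro: lipschitz_on_subset)
qed

text \<open>The increment W(r,t) = J r (t + tau) - J r t satisfies the linear equation
  W_t = e^(-2V(t+tau)) (W_rr - ((2P - f')/f) W_r). Here u stands for t + tau, W2 for W_rr and -q
  for W_r.\<close>

lemma increment_sign:
  assumes r: "r \<in> {-\<rho>..\<rho>}" and t: "0 \<le> t" "t < T" and \<Lambda>: "\<bar>f1 r\<bar> + 2 * slope_bound \<le> \<Lambda> * f r"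
    and q: "q \<ge> 0" "m r u - m r t = - q"
    and W2: "W2 = exp (2 * V r u) * (2 * P r u - f1 r) - exp (2 * V r t) * (2 * P r t - f1 r)"
  shows "W2 \<le> - \<Lambda> * q \<Longrightarrow> P r u \<le> P r t" and "W2 \<ge> \<Lambda> * q \<Longrightarrow> P r u \<ge> P r t"
proof -
  \<comment> \<open>\<open>k\<close> is the coefficient of W_r in the linear equation;
    \<open>P_bound\<close> and the choice of \<open>\<Lambda>\<close> give |k| at most
    \<open>\<Lambda>\<close>.\<close>
  define k where "k = (2 * P r t - f1 r) / f r"
  have fr: "f r > 0" using f(1)[OF r] .
  have "\<bar>2 * P r t - f1 r\<bar> \<le> \<Lambda> * f r" using P_bound[OF r t] \<Lambda> by linarith
  then have k: "\<bar>k\<bar> \<le> \<Lambda>" using fr by (simp add: k_def abs_divide pos_divide_le_eq)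
  then have kq: "k * q \<le> \<Lambda> * q" "- \<Lambda> * q \<le> k * q"
    using q(1) by (intro mult_right_mono; linarith)+
  have ident: "a * (2 * x - c) - b * (2 * y - c) - (2 * y - c) * (a - b) = a * (2 * x - 2 * y)"
    for a b c x y :: real by (simp add: algebra_simps)
  have "k * (m r u - m r t) = (2 * P r t - f1 r) * (exp (2 * V r u) - exp (2 * V r t))"
    using fr by (simp add: m_def k_def divide_simps left_diff_distrib[symmetric])
  then have "W2 - k * (m r u - m r t) = exp (2 * V r u) * (2 * P r u - 2 * P r t)"
    unfolding W2 by (simp only: ident)
  \<comment> \<open>This is the linear equation: the right side is a positive factor times W_t, and
    on the left \<open>k * q\<close> is dominated by \<open>\<Lambda> * q\<close>, so
    \<open>W2\<close> decides the sign.\<close>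
  then have eq: "W2 + k * q = exp (2 * V r u) * (2 * P r u - 2 * P r t)" using q(2) by simp
  show "P r u \<le> P r t" if "W2 \<le> - \<Lambda> * q"
  proof -
    have "exp (2 * V r u) * (2 * P r u - 2 * P r t) \<le> 0" using eq kq that by linarith
    then show ?thesis by (simp add: mult_le_0_iff)
  qed
  show "P r u \<ge> P r t" if "W2 \<ge> \<Lambda> * q"
  proof -
    have "exp (2 * V r u) * (2 * P r u - 2 * P r t) \<ge> 0" using eq kq that by linarith
    then show ?thesis by (simp add: zero_le_mult_iff)
  qed
qed

text \<open>A maximum principle in the pair (x, y) uses the derivatives in \<open>x\<close> and in
  \<open>y\<close> separately. At a touching pair, the second-order tests with
  \<open>increment_sign\<close>, or at an end the boundary condition, show that W_t is nonpositive
  at \<open>x\<close> and nonnegative at \<open>y\<close>, which contradicts the strictly growing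
  barrier. The constant \<open>M\<close> is fixed by early times alone.\<close>

lemma two_point_estimate:
  assumes s0: "s0 < T" and D: "\<And>r s. r \<in> {-\<rho>..\<rho>} \<Longrightarrow> 0 \<le> s \<Longrightarrow> s \<le> s0 \<Longrightarrow> - D \<le> P' r s"
    and \<Lambda>: "\<Lambda> > 0" "\<And>r. r \<in> {-\<rho>..\<rho>} \<Longrightarrow> \<bar>f1 r\<bar> + 2 * slope_bound \<le> \<Lambda> * f r"
    and \<tau>: "0 < \<tau>" "\<tau> \<le> s0" and M: "M = 2 * D * exp (2 * \<Lambda> * \<rho>) / \<Lambda>"
    and t: "0 \<le> t" "t + \<tau> < T" and xy: "-\<rho> \<le> x" "x \<le> y" "y \<le> \<rho>"
  shows "(J x (t + \<tau>) - J x t) - (J y (t + \<tau>) - J y t) \<le> \<tau> * (M * (1 - exp (- \<Lambda> * (y - x))))"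
proof (rule field_le_epsilon)
  fix e :: real assume "e > 0"
  define \<epsilon> where "\<epsilon> = e / (1 + t)"
  have \<epsilon>: "\<epsilon> > 0" using \<open>e > 0\<close> t by (simp add: \<epsilon>_def)
  have "D \<ge> 0" using D[of 0 0] P'_nonpos[of 0 0] \<rho> T \<tau> by auto
  then have M0: "M \<ge> 0" using \<Lambda> by (simp add: M)
  \<comment> \<open>\<open>\<Theta>\<close> vanishes at 0 and its second derivative is
    \<open>- \<Lambda>\<close> times its first; this concavity absorbs the first-order term of the
    linear equation.\<close>
  define \<Theta> where "\<Theta> = (\<lambda>z. M * (1 - exp (- \<Lambda> * z)))"
  define \<Theta>' where "\<Theta>' = (\<lambda>z. M * \<Lambda> * exp (- \<Lambda> * z))"
  have \<Theta>'0: "\<Theta>' z \<ge> 0" for z using M0 \<Lambda> by (simp add: \<Theta>'_def)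
  have \<Theta>_deriv [derivative_intros]: "((\<lambda>x. \<Theta> (g x)) has_real_derivative \<Theta>' (g x) * g') (at x)"
    and \<Theta>'_deriv [derivative_intros]: "((\<lambda>x. \<Theta>' (g x)) has_real_derivative - \<Lambda> * \<Theta>' (g x) * g') (at x)"
    if "(g has_real_derivative g') (at x)" for g g' x
    unfolding \<Theta>_def \<Theta>'_def using that by (auto intro!: derivative_eq_intros)
  define W where "W = (\<lambda>r t. J r (t + \<tau>) - J r t)"
  define F where "F = (\<lambda>z t. W (fst z) t - W (snd z) t - \<tau> * \<Theta> (snd z - fst z) - \<epsilon> * (1 + t))"
  define K where "K = ({-\<rho>..\<rho>} \<times> {-\<rho>..\<rho>}) \<inter> {z. fst z \<le> (snd z :: real)}"
  have "F (x, y) t < 0"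
  proof (rule negative_if_no_first_touching[of K t F])
    show "compact K" unfolding K_def
      by (intro compact_Int_closed compact_Times compact_Icc closed_Collect_le continuous_intros)
    have cW: "continuous_on (K \<times> {0..t}) (\<lambda>z. W (h (fst z)) (snd z))"
      if h: "continuous_on K h" "h ` K \<subseteq> {-\<rho>..\<rho>}" for h
    proof -
      have c: "continuous_on (K \<times> {0..t}) (\<lambda>z. (\<lambda>(r, t). J r t) (h (fst z), snd z + c))"
        if "0 \<le> c" "c \<le> \<tau>" for c
        by (rule continuous_on_compose2[OF cont_J])
          (use that h t in \<open>auto intro!: continuous_intros continuous_on_compose2[OF h(1)]\<close>)
      show ?thesis unfolding W_def using c[of \<tau>] c[of 0] \<tau> by (auto intro!: continuous_intros)
    qed
    show "continuous_on (K \<times> {0..t}) (\<lambda>(z, t). F z t)"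
      unfolding F_def case_prod_unfold \<Theta>_def
      by (intro continuous_intros cW) (auto simp: K_def)
    show "F z 0 < 0" if "z \<in> K" for z
    proof -
      obtain x y where z: "z = (x, y)" "-\<rho> \<le> x" "x \<le> y" "y \<le> \<rho>" using \<open>z \<in> K\<close> by (auto simp: K_def)
      \<comment> \<open>At time 0 the increment integrates \<open>2 * P\<close> over times up to
        \<open>\<tau>\<close>, hence within \<open>s0\<close>, where \<open>D\<close> controls the
        slope.\<close>
      have P: "P x s - P y s \<le> D * (y - x)" if "0 \<le> s" "s \<le> s0" for s
      proof -
        have "P x s + D * x \<le> P y s + D * y"
        proof (rule DERIV_nonneg_imp_nondecreasing[OF \<open>x \<le> y\<close>])
          show "\<exists>d. ((\<lambda>r. P r s + D * r) has_real_derivative d) (at r) \<and> 0 \<le> d" if "x \<le> r" "r \<le> y" for r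
            using D[of r s] \<open>0 \<le> s\<close> \<open>s \<le> s0\<close> s0 that z
            by (intro exI[of _ "P' r s + D"]) (auto intro!: derivative_eq_intros P_deriv)
        qed
        then show ?thesis by (simp add: algebra_simps)
      qed
      define h where "h = (\<lambda>s. J x s - J y s - 2 * D * (y - x) * s)"
      have "h \<tau> \<le> h 0"
      proof (rule DERIV_nonpos_imp_decreasing_open[of 0 \<tau> h])
        have "continuous_on {0..\<tau>} (J r)" if "r \<in> {-\<rho>..\<rho>}" for r
          by (rule continuous_on_subset[OF cont_time[OF cont_J that]]) (use \<tau> s0 in auto)
        then show "continuous_on {0..\<tau>} h" unfolding h_def using z
          by (intro continuous_intros) auto
        show "\<exists>d. (h has_real_derivative d) (at s) \<and> d \<le> 0" if "0 < s" "s < \<tau>" for s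
          unfolding h_def using P[of s] \<tau> s0 z that
          by (intro exI[of _ "2 * P x s - 2 * P y s - 2 * D * (y - x)"])
            (auto intro!: derivative_eq_intros J_deriv_time)
      qed (use \<tau> in simp)
      then have 1: "J x \<tau> - J y \<tau> \<le> 2 * D * (y - x) * \<tau>" by (simp add: h_def J_def)
      \<comment> \<open>\<open>M\<close> is chosen for this: on [0, 2 \<rho>] the derivative of
        \<open>\<Theta>\<close> is at least \<open>2 * D\<close>.\<close>
      have "2 * D * (y - x) \<le> \<Theta> (y - x)"
      proof -
        have "exp (\<Lambda> * (y - x)) \<ge> 1 + \<Lambda> * (y - x)" by (rule exp_ge_add_one_self)
        then have "(exp (\<Lambda> * (y - x)) - 1) * exp (- \<Lambda> * (y - x)) \<ge> \<Lambda> * (y - x) * exp (- \<Lambda> * (y - x))"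
          by (intro mult_right_mono) (linarith, simp)
        then have "1 - exp (- \<Lambda> * (y - x)) \<ge> \<Lambda> * (y - x) * exp (- \<Lambda> * (y - x))"
          by (simp add: left_diff_distrib exp_add[symmetric])
        moreover have "- \<Lambda> * (y - x) \<ge> - \<Lambda> * (2 * \<rho>)"
          using z \<Lambda> by (intro mult_left_mono_neg) auto
        then have "\<Lambda> * (y - x) * exp (- \<Lambda> * (y - x)) \<ge> \<Lambda> * (y - x) * exp (- \<Lambda> * (2 * \<rho>))"
          using z \<Lambda> by (intro mult_left_mono) auto
        ultimately have "\<Theta> (y - x) \<ge> M * (\<Lambda> * (y - x) * exp (- \<Lambda> * (2 * \<rho>)))"
          unfolding \<Theta>_def using M0 by (intro mult_left_mono) auto
        also have "M * (\<Lambda> * (y - x) * exp (- \<Lambda> * (2 * \<rho>))) =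
            2 * D * (y - x) * (exp (2 * \<Lambda> * \<rho>) * exp (- \<Lambda> * (2 * \<rho>)))"
          using \<Lambda> by (simp add: M)
        also have "\<dots> = 2 * D * (y - x)" by (simp add: exp_add[symmetric])
        finally show ?thesis .
      qed
      then have "2 * D * (y - x) * \<tau> \<le> \<tau> * \<Theta> (y - x)" using \<tau> by (simp add: mult.commute)
      then show ?thesis using 1 \<epsilon> z by (simp add: F_def W_def J_def)
    qed
    fix z s assume "z \<in> K" and s: "0 < s" "s \<le> t" and "F z s = 0"
      and le: "\<And>z' t'. z' \<in> K \<Longrightarrow> 0 \<le> t' \<Longrightarrow> t' \<le> s \<Longrightarrow> F z' t' \<le> 0"
    then obtain x y where z: "z = (x, y)" "-\<rho> \<le> x" "x \<le> y" "y \<le> \<rho>" by (auto simp: K_def)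
    have zero: "F (x, y) s = 0" using \<open>F z s = 0\<close> z by simp
    \<comment> \<open>On the diagonal \<open>F\<close> equals \<open>- \<epsilon> * (1 + s)\<close>,
      so no touching happens there.\<close>
    have "x \<noteq> y" using zero \<epsilon> s by (auto simp: F_def \<Theta>_def)
    then have "x < y" using z by simp
    have sT: "s + \<tau> < T" "s < T" using s t \<tau> by auto
    have in_K: "(a, b) \<in> K" if "-\<rho> \<le> a" "a \<le> b" "b \<le> \<rho>" for a b using that by (auto simp: K_def)
    define q where "q = \<tau> * \<Theta>' (y - x)"
    have q: "q \<ge> 0" using \<tau> \<Theta>'0 by (simp add: q_def)
    have W_space: "((\<lambda>r. W r s) has_real_derivative m r (s + \<tau>) - m r s) (at r)" if "-\<rho> < r" "r < \<rho>" for r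
    proof -
      have "((\<lambda>r. W r s) has_real_derivative (m r (s + \<tau>) - m r 0) - (m r s - m r 0)) (at r within {-\<rho>..\<rho>})"
        unfolding W_def by (intro DERIV_diff J_deriv_space) (use that s sT \<tau> in auto)
      then show ?thesis using at_within_Icc_at[OF that] by simp
    qed
    define W2 where "W2 = (\<lambda>r. exp (2 * V r (s + \<tau>)) * (2 * P r (s + \<tau>) - f1 r)
        - exp (2 * V r s) * (2 * P r s - f1 r))"
    have W_space2: "((\<lambda>r. m r (s + \<tau>) - m r s) has_real_derivative W2 r) (at r)" if "-\<rho> < r" "r < \<rho>" for r
      unfolding W2_def by (intro DERIV_diff m_deriv_space) (use that s sT \<tau> in auto)
    have mono_end: "V r (s + \<tau>) \<le> V r s" if "r \<in> {-\<rho>..\<rho>}" for r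
      using V_antimono[OF that, of s \<tau>] s sT \<tau> by auto
    have bc': "P r u = f1 r * exp (V r u)" if "r \<in> {-\<rho>, \<rho>}" "0 \<le> u" "u < T" for r u
      using bc[OF that(1), of u] that by (simp add: P_def)
    have 1: "P x (s + \<tau>) \<le> P x s"
    proof (cases "x = -\<rho>")
      case True
      \<comment> \<open>At the left end \<open>P\<close> is \<open>f1 x * exp (V x s)\<close> with
        \<open>f1\<close> nonnegative, and \<open>V\<close> decreases in time. The right end is the
        mirror image.\<close>
      then show ?thesis
        using bc'[of x] mono_end[of x] f1(3) s sT \<tau> \<rho> by (auto intro: mult_left_mono)
    next
      case False
      \<comment> \<open>The window \<open>{a..b}\<close> keeps \<open>x\<close> in its interior,
        avoids the boundary circle, and stays left of \<open>y\<close>, so its pairs with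
        \<open>y\<close> remain in \<open>K\<close>.\<close>
      define a where "a = (x - \<rho>) / 2"
      define b where "b = (x + y) / 2"
      have ab: "-\<rho> < a" "a < x" "x < b" "b < y" using False z \<open>x < y\<close> by (auto simp: a_def b_def field_simps)
      define D1 where "D1 = (\<lambda>r. m r (s + \<tau>) - m r s + \<tau> * \<Theta>' (y - r))"
      have d1: "((\<lambda>r. F (r, y) s) has_real_derivative D1 r) (at r)" if "r \<in> {a..b}" for r
        unfolding F_def D1_def fst_conv snd_conv
        by (rule derivative_eq_intros W_space refl | (use that ab z in \<open>force\<close>))+
      have d2: "(D1 has_real_derivative W2 x + \<Lambda> * q) (at x)"
        unfolding D1_def q_def
        by (rule derivative_eq_intros W_space2 refl | (use ab z in \<open>force\<close>))+
      have max: "F (r, y) s \<le> F (x, y) s" if "r \<in> {a..b}" for r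
        using le[OF in_K, of r y s] that ab z s zero by auto
      have dx: "((\<lambda>r. F (r, y) s) has_real_derivative D1 x) (at x within {a..b})"
        using d1[of x] ab by (auto intro: has_field_derivative_at_within)
      have D10: "D1 x = 0"
        using deriv_nonpos_at_max[OF dx _ _ max] deriv_nonneg_at_max[OF dx _ _ max] ab by force
      \<comment> \<open>The vanishing of \<open>D1 x\<close> says W_r = -q at \<open>x\<close>, and
        the term \<open>\<Lambda> * q\<close> comes from the concavity of
        \<open>\<Theta>\<close>.\<close>
      have "W2 x + \<Lambda> * q \<le> 0"
        by (rule second_deriv_nonpos_at_max[OF d1 d2 D10 _ _ max]) (use ab in auto)
      then show ?thesis
        using increment_sign(1)[of x s \<Lambda> q "s + \<tau>" "W2 x"] D10 \<Lambda> q z s sT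
        by (auto simp: D1_def q_def[symmetric] W2_def)
    qed
    have 2: "P y (s + \<tau>) \<ge> P y s"
    proof (cases "y = \<rho>")
      case True
      then show ?thesis
        using bc'[of y] mono_end[of y] f1(2) s sT \<tau> \<rho> by (auto intro: mult_left_mono_neg)
    next
      case False
      define a where "a = (x + y) / 2"
      define b where "b = (y + \<rho>) / 2"
      have ab: "x < a" "a < y" "y < b" "b < \<rho>" using False z \<open>x < y\<close> by (auto simp: a_def b_def field_simps)
      define D1 where "D1 = (\<lambda>r. - (m r (s + \<tau>) - m r s) - \<tau> * \<Theta>' (r - x))"
      have d1: "((\<lambda>r. F (x, r) s) has_real_derivative D1 r) (at r)" if "r \<in> {a..b}" for r
        unfolding F_def D1_def fst_conv snd_conv
        by (rule derivative_eq_intros W_space refl | (use that ab z in \<open>force\<close>))+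
      have d2: "(D1 has_real_derivative - W2 y + \<Lambda> * q) (at y)"
        unfolding D1_def q_def
        by (rule derivative_eq_intros W_space2 refl | (use ab z in \<open>force\<close>))+
      have max: "F (x, r) s \<le> F (x, y) s" if "r \<in> {a..b}" for r
        using le[OF in_K, of x r s] that ab z s zero by auto
      have dx: "((\<lambda>r. F (x, r) s) has_real_derivative D1 y) (at y within {a..b})"
        using d1[of y] ab by (auto intro: has_field_derivative_at_within)
      have D10: "D1 y = 0"
        using deriv_nonpos_at_max[OF dx _ _ max] deriv_nonneg_at_max[OF dx _ _ max] ab by force
      have "- W2 y + \<Lambda> * q \<le> 0"
        by (rule second_deriv_nonpos_at_max[OF d1 d2 D10 _ _ max]) (use ab in auto)
      then show ?thesis
        using increment_sign(2)[of y s \<Lambda> q "s + \<tau>" "W2 y"] D10 \<Lambda> q z s sT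
        by (auto simp: D1_def q_def[symmetric] W2_def)
    qed
    have W_time: "((\<lambda>s. W r s) has_real_derivative 2 * P r (s + \<tau>) - 2 * P r s) (at s)"
      if "r \<in> {-\<rho>..\<rho>}" for r
      unfolding W_def using J_deriv_time[OF that, of "s + \<tau>"] J_deriv_time[OF that, of s] s sT \<tau>
      by (intro DERIV_diff) (simp_all add: DERIV_shift)
    have "((\<lambda>s. F (x, y) s) has_real_derivative
        (2 * P x (s + \<tau>) - 2 * P x s) - (2 * P y (s + \<tau>) - 2 * P y s) - \<epsilon>) (at s)"
      unfolding F_def fst_conv snd_conv
      by (rule derivative_eq_intros W_time refl | (use z in \<open>force\<close>))+
    then have "(F (x, y) has_real_derivative
        (2 * P x (s + \<tau>) - 2 * P x s) - (2 * P y (s + \<tau>) - 2 * P y s) - \<epsilon>) (at s within {0..s})"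
      by (rule has_field_derivative_at_within)
    then have "(2 * P x (s + \<tau>) - 2 * P x s) - (2 * P y (s + \<tau>) - 2 * P y s) - \<epsilon> \<ge> 0"
      by (rule deriv_nonneg_at_max) (use s zero le[OF in_K, of x y] z in auto)
    then show False using 1 2 \<epsilon> by linarith
  qed (use xy t in \<open>auto simp: K_def\<close>)
  moreover have "\<epsilon> * (1 + t) = e" using t by (simp add: \<epsilon>_def)
  ultimately show "(J x (t + \<tau>) - J x t) - (J y (t + \<tau>) - J y t)
      \<le> \<tau> * (M * (1 - exp (- \<Lambda> * (y - x)))) + e"
    by (simp add: F_def W_def \<Theta>_def)
qed

section \<open>Uniform lower bound for the space derivative of P\<close>

text \<open>Dividing the two-point estimate by \<open>\<tau>\<close> and letting
  \<open>\<tau>\<close> tend to 0 bounds the difference quotients of \<open>P\<close>. The bound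
  depends on \<open>D\<close>, \<open>\<Lambda>\<close> and \<open>\<rho>\<close> only, not on
  \<open>t\<close> or \<open>T\<close>.\<close>

lemma P'_lower_bound:
  assumes s0: "0 < s0" "s0 < T" and D: "\<And>r s. r \<in> {-\<rho>..\<rho>} \<Longrightarrow> 0 \<le> s \<Longrightarrow> s \<le> s0 \<Longrightarrow> - D \<le> P' r s"
    and \<Lambda>: "\<Lambda> > 0" "\<And>r. r \<in> {-\<rho>..\<rho>} \<Longrightarrow> \<bar>f1 r\<bar> + 2 * slope_bound \<le> \<Lambda> * f r"
    and r: "r \<in> {-\<rho>..\<rho>}" and t: "0 < t" "t < T"
  shows "- (D * exp (2 * \<Lambda> * \<rho>)) \<le> P' r t"
proof -
  define M where "M = 2 * D * exp (2 * \<Lambda> * \<rho>) / \<Lambda>"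
  have "D \<ge> 0" using D[of 0 0] P'_nonpos[of 0 0] \<rho> T s0 by auto
  define c where "c = D * exp (2 * \<Lambda> * \<rho>)"
  have Mc: "M * \<Lambda> = 2 * c" "M \<ge> 0" using \<Lambda> \<open>D \<ge> 0\<close> by (simp_all add: M_def c_def)
  have slope: "P x t + c * x \<le> P y t + c * y" if xy: "-\<rho> \<le> x" "x \<le> y" "y \<le> \<rho>" for x y
  proof -
    \<comment> \<open>Up to time \<open>b\<close> the increment \<open>u - t\<close> is at most
      \<open>s0\<close> and \<open>u\<close> stays below \<open>T\<close>, as
      \<open>two_point_estimate\<close> demands. The limit is taken as the right derivative of
      \<open>H\<close> at its maximum \<open>t\<close>.\<close>
    define b where "b = min (t + s0) ((t + T) / 2)"
    define H where "H = (\<lambda>u. (J x u - J x t) - (J y u - J y t) - (u - t) * (2 * c * (y - x)))"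
    have "(H has_real_derivative 2 * P x t - 2 * P y t - 2 * c * (y - x)) (at t)"
      unfolding H_def by (rule derivative_eq_intros J_deriv_time refl | (use t xy in \<open>force\<close>))+
    then have "(H has_real_derivative 2 * P x t - 2 * P y t - 2 * c * (y - x)) (at t within {t..b})"
      by (rule has_field_derivative_at_within)
    then have "2 * P x t - 2 * P y t - 2 * c * (y - x) \<le> 0"
    proof (rule deriv_nonpos_at_max)
      fix u assume u: "u \<in> {t..b}"
      show "H u \<le> H t"
      proof (cases "u = t")
        case False
        then have "u > t" "u - t \<le> s0" "u < T" using u t by (auto simp: b_def)
        then have "(J x u - J x t) - (J y u - J y t) \<le> (u - t) * (M * (1 - exp (- \<Lambda> * (y - x))))"
          using two_point_estimate[OF s0(2) D \<Lambda>, of "u - t" M t x y] xy t by (simp add: M_def)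
        also have "\<dots> \<le> (u - t) * (M * (\<Lambda> * (y - x)))"
          using exp_ge_add_one_self[of "- \<Lambda> * (y - x)"] \<open>u > t\<close> Mc(2) by (intro mult_left_mono) auto
        also have "M * (\<Lambda> * (y - x)) = 2 * c * (y - x)" using Mc(1) by (simp add: mult.assoc[symmetric])
        finally show ?thesis by (simp add: H_def)
      qed simp
    qed (use t s0 in \<open>auto simp: b_def\<close>)
    then show ?thesis by (simp add: algebra_simps)
  qed
  have dP: "((\<lambda>r. P r t + c * r) has_real_derivative P' r t + c) (at r within {-\<rho>..r})"
    "((\<lambda>r. - (P r t + c * r)) has_real_derivative - (P' r t + c)) (at r within {r..\<rho>})"
    using t by (auto intro!: derivative_eq_intros has_field_derivative_at_within[OF P_deriv])
  have "P' r t + c \<ge> 0"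
  proof (cases "r = \<rho>")
    case True
    show ?thesis by (rule deriv_nonneg_at_max[OF dP(1)]) (use True \<rho> slope in auto)
  next
    case False
    have "- (P r' t + c * r') \<le> - (P r t + c * r)" if "r' \<in> {r..\<rho>}" for r'
      using slope[of r r'] r that by auto
    then have "- (P' r t + c) \<le> 0" by (intro deriv_nonpos_at_max[OF dP(2)]) (use False r in auto)
    then show ?thesis by simp
  qed
  then show ?thesis by (simp add: c_def)
qed

end

section \<open>From the normalised to the unnormalised flow\<close>

locale normalised_flow =
  fixes f :: "real \<Rightarrow> real" and \<rho> :: real and w :: "real \<Rightarrow> real \<Rightarrow> real"
  assumes rho_pos: "\<rho> > 0"
    and f_smooth: "smooth_fun f"
    and f_pos: "\<And>r. r \<in> {-\<rho>..\<rho>} \<Longrightarrow> f r > 0"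
    and R0_nonneg: "\<And>r. r \<in> {-\<rho>..\<rho>} \<Longrightarrow> scal_rot (\<lambda>_. 1) f r \<ge> 0"
    and k0_nonpos: "geod_curv_top (\<lambda>_. 1) f \<rho> \<le> 0" "geod_curv_bot (\<lambda>_. 1) f \<rho> \<le> 0"
    and flow: "normalised_rot_flow f \<rho> w"
begin

definition w1 where "w1 r t = deriv (\<lambda>s. w s t) r"
definition w2 where "w2 r t = deriv (deriv (\<lambda>s. w s t)) r"
text \<open>Subtracting a function of time from \<open>w\<close> leaves its space derivatives alone,
  so \<open>p\<close> and \<open>p'\<close> are the \<open>P\<close> and \<open>P'\<close> of the
  unnormalised flow at the corresponding time.\<close>

definition p where "p r t = f r * w1 r t + deriv f r"
definition p' where "p' r t = f r * w2 r t + deriv f r * w1 r t + deriv (deriv f) r"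
text \<open>This is ln phi.\<close>

definition \<psi> where "\<psi> t = integral {0..t} (flow_r f \<rho> w)"

lemma f_deriv: "(f has_real_derivative deriv f r) (at r)"
  and f1_deriv: "(deriv f has_real_derivative deriv (deriv f) r) (at r)"
  and cont_f2: "continuous_on A (deriv (deriv f))"
proof -
  have d: "(deriv ^^ n) f differentiable (at x)" for n x using f_smooth by (simp add: smooth_fun_def)
  show "(f has_real_derivative deriv f r) (at r)"
    using d[of 0 r] by (simp add: DERIV_deriv_iff_real_differentiable)
  show "(deriv f has_real_derivative deriv (deriv f) r) (at r)"
    using d[of 1 r] by (simp add: DERIV_deriv_iff_real_differentiable)
  show "continuous_on A (deriv (deriv f))"
    using d[of 2] by (intro continuous_at_imp_continuous_on ballI differentiable_imp_continuous_within)
      (simp add: numeral_2_eq_2)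
qed

lemma cont_f: "continuous_on A f" and cont_f1: "continuous_on A (deriv f)"
  using f_deriv f1_deriv by (meson DERIV_continuous continuous_at_imp_continuous_on)+

lemma w_deriv: "0 \<le> t \<Longrightarrow> ((\<lambda>r. w r t) has_real_derivative w1 r t) (at r)"
  and w1_deriv: "0 \<le> t \<Longrightarrow> ((\<lambda>r. w1 r t) has_real_derivative w2 r t) (at r)"
  using flow unfolding w1_def w2_def normalised_rot_flow_def
  by (auto simp: DERIV_deriv_iff_real_differentiable)

lemma cont_w: "continuous_on ({-\<rho>..\<rho>} \<times> {0..}) (\<lambda>(r, t). w r t)"
  and cont_w1: "continuous_on ({-\<rho>..\<rho>} \<times> {0..}) (\<lambda>(r, t). w1 r t)"
  and cont_w2: "continuous_on ({-\<rho>..\<rho>} \<times> {0..}) (\<lambda>(r, t). w2 r t)"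
  using flow unfolding w1_def w2_def normalised_rot_flow_def by auto

lemma p_deriv: "0 \<le> t \<Longrightarrow> ((\<lambda>r. p r t) has_real_derivative p' r t) (at r)"
  unfolding p_def p'_def by (auto intro!: derivative_eq_intros w1_deriv f_deriv f1_deriv)

lemma cont_p: "continuous_on ({-\<rho>..\<rho>} \<times> {0..}) (\<lambda>(r, t). p r t)"
  and cont_p': "continuous_on ({-\<rho>..\<rho>} \<times> {0..}) (\<lambda>(r, t). p' r t)"
  unfolding p_def p'_def case_prod_unfold using cont_w1 cont_w2
  by (auto simp: case_prod_unfold
      intro!: continuous_intros continuous_on_compose2[OF cont_f[of UNIV]]
        continuous_on_compose2[OF cont_f1[of UNIV]] continuous_on_compose2[OF cont_f2[of UNIV]])

lemma deriv_flow_b: "0 \<le> t \<Longrightarrow> deriv (flow_b f w t) r = exp (w r t) * p r t"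
  unfolding flow_b_def p_def
  by (rule DERIV_imp_deriv) (auto intro!: derivative_eq_intros w_deriv f_deriv simp: algebra_simps)

text \<open>The factor \<open>exp (w r t)\<close> in the derivative of \<open>flow_b\<close> cancels
  against \<open>flow_a\<close>, so the quotient differentiated in \<open>scal_rot\<close> is just
  \<open>p\<close>.\<close>

lemma flow_R_eq:
  assumes t: "0 \<le> t"
  shows "flow_R f w r t = - 2 * exp (- 2 * w r t) * p' r t / f r"
proof -
  have "(\<lambda>s. deriv (flow_b f w t) s / flow_a w t s) = (\<lambda>s. p s t)"
    using t by (simp add: deriv_flow_b flow_a_def)
  moreover have "deriv (\<lambda>s. p s t) r = p' r t" by (rule DERIV_imp_deriv[OF p_deriv[OF t]])
  moreover have "exp (- 2 * w r t) = 1 / (exp (w r t) * exp (w r t))"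
    by (simp add: exp_add[symmetric] exp_minus[symmetric] inverse_eq_divide[symmetric])
  ultimately show ?thesis
    by (simp add: flow_R_def scal_rot_def flow_a_def flow_b_def)
qed

text \<open>Gauss-Bonnet in this setting: R dA is an exact derivative in \<open>r\<close>, leaving
  boundary terms. Its use is the continuity of the total curvature in time.\<close>

lemma flow_r_eq:
  assumes t: "0 \<le> t"
  shows "flow_r f \<rho> w t = - 4 * pi * (p \<rho> t - p (-\<rho>) t)"
proof -
  have "integral {-\<rho>..\<rho>} (\<lambda>s. scal_rot (flow_a w t) (flow_b f w t) s * flow_a w t s * flow_b f w t s)
      = integral {-\<rho>..\<rho>} (\<lambda>s. - 2 * p' s t)"
  proof (rule integral_cong)
    fix s assume s: "s \<in> {-\<rho>..\<rho>}"
    have "exp (- 2 * w s t) * exp (w s t) * exp (w s t) = 1" by (simp add: exp_add[symmetric])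
    moreover have "- 2 * exp (- 2 * w s t) * p' s t / f s * exp (w s t) * (exp (w s t) * f s)
        = - 2 * (exp (- 2 * w s t) * exp (w s t) * exp (w s t)) * p' s t"
      using f_pos[OF s] by simp
    ultimately show "scal_rot (flow_a w t) (flow_b f w t) s * flow_a w t s * flow_b f w t s = - 2 * p' s t"
      using flow_R_eq[OF t, of s] unfolding flow_R_def by (simp only: flow_a_def flow_b_def)
  qed
  also have "((\<lambda>s. - 2 * p' s t) has_integral - 2 * p \<rho> t - - 2 * p (-\<rho>) t) {-\<rho>..\<rho>}"
  proof (rule fundamental_theorem_of_calculus)
    show "((\<lambda>s. - 2 * p s t) has_vector_derivative - 2 * p' x t) (at x within {-\<rho>..\<rho>})" for x
      unfolding has_real_derivative_iff_has_vector_derivative[symmetric]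
      by (rule has_field_derivative_at_within[OF DERIV_cmult[OF p_deriv[OF t]]])
  qed (use rho_pos in simp)
  then have "integral {-\<rho>..\<rho>} (\<lambda>s. - 2 * p' s t) = - 2 * p \<rho> t - - 2 * p (-\<rho>) t"
    by (rule integral_unique)
  finally show ?thesis
    unfolding flow_r_def tot_scal_rot_def by (simp only:) (simp add: algebra_simps)
qed

lemma cont_flow_r: "continuous_on {0..} (flow_r f \<rho> w)"
proof -
  have c: "continuous_on {0..} (\<lambda>t. (\<lambda>(r, t). p r t) (r, t))" if "r \<in> {-\<rho>..\<rho>}" for r
    by (rule continuous_on_compose2[OF cont_p]) (use that in \<open>auto intro!: continuous_intros\<close>)
  have "continuous_on {0..} (\<lambda>t. - 4 * pi * (p \<rho> t - p (-\<rho>) t))"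
    using c[of \<rho>] c[of "-\<rho>"] rho_pos by (auto intro!: continuous_intros)
  then show ?thesis by (rule continuous_on_eq) (simp add: flow_r_eq)
qed

lemma \<psi>_deriv: "0 \<le> t \<Longrightarrow> t \<le> b \<Longrightarrow> (\<psi> has_real_derivative flow_r f \<rho> w t) (at t within {0..b})"
  unfolding \<psi>_def[abs_def]
  by (rule integral_has_real_derivative) (auto intro: continuous_on_subset[OF cont_flow_r])

lemma cont_\<psi>: "continuous_on {0..b} \<psi>"
  unfolding continuous_on_eq_continuous_within by (intro ballI DERIV_continuous[OF \<psi>_deriv]) auto

lemma sqrt_phi: "sqrt (flow_phi f \<rho> w t) = exp (\<psi> t / 2)"
  by (rule real_sqrt_unique) (auto simp: flow_phi_def \<psi>_def exp_double[symmetric])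

lemma boundary:
  assumes t: "0 \<le> t" and r: "r \<in> {-\<rho>, \<rho>}"
  shows "p r t = deriv f r * exp (w r t - \<psi> t / 2)"
proof -
  have "f r > 0" using r f_pos[of r] rho_pos by auto
  have "deriv (flow_b f w t) r / (flow_a w t r * flow_b f w t r) = deriv f r / (1 * f r) / exp (\<psi> t / 2)"
    using flow t r unfolding normalised_rot_flow_def geod_curv_top_def geod_curv_bot_def sqrt_phi
    by fastforce
  then have "exp (w r t) * p r t / (exp (w r t) * (exp (w r t) * f r)) * (exp (w r t) * f r)
      = deriv f r / (1 * f r) / exp (\<psi> t / 2) * (exp (w r t) * f r)"
    by (simp only: deriv_flow_b[OF t] flow_a_def) (simp only: flow_b_def)
  then show ?thesis using \<open>f r > 0\<close> by (simp add: exp_diff)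
qed

lemma f1_signs: "deriv f \<rho> \<le> 0" "deriv f (-\<rho>) \<ge> 0"
  using k0_nonpos f_pos[of \<rho>] f_pos[of "-\<rho>"] rho_pos
  by (auto simp: geod_curv_top_def geod_curv_bot_def divide_le_0_iff zero_le_divide_iff)

lemma f2_nonpos: "r \<in> {-\<rho>..\<rho>} \<Longrightarrow> deriv (deriv f) r \<le> 0"
  using R0_nonneg[of r] f_pos[of r] by (auto simp: scal_rot_def zero_le_mult_iff divide_le_0_iff zero_le_divide_iff)

text \<open>The total curvature cancels on subtracting half of ln phi.\<close>

lemma rescaled_deriv:
  assumes r: "r \<in> {-\<rho>..\<rho>}" and t: "0 < t"
  shows "((\<lambda>t. w r t - \<psi> t / 2) has_real_derivative exp (- 2 * w r t) * p' r t / f r) (at t)"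
proof -
  have "((\<lambda>\<tau>. 2 * w r \<tau>) has_real_derivative (flow_r f \<rho> w t - flow_R f w r t)) (at t within {0..})"
    using flow r t unfolding normalised_rot_flow_def by auto
  then have 1: "((\<lambda>\<tau>. 2 * w r \<tau>) has_real_derivative (flow_r f \<rho> w t - flow_R f w r t)) (at t)"
    using at_within_interior[of t "{0..}"] t by simp
  have 2: "(\<psi> has_real_derivative flow_r f \<rho> w t) (at t)"
    using \<psi>_deriv[of t "t + 1"] t at_within_Icc_at[of 0 t "t + 1"] by simp
  have "((\<lambda>\<tau>. (2 * w r \<tau> - \<psi> \<tau>) / 2) has_real_derivative
      (flow_r f \<rho> w t - flow_R f w r t - flow_r f \<rho> w t) / 2) (at t)"
    by (intro DERIV_cdivide DERIV_diff 1 2)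
  then show ?thesis using t by (simp add: flow_R_eq diff_divide_distrib)
qed

text \<open>For each \<open>t\<close> the flow is transferred to a finite unnormalised time
  interval; the constants there do not depend on its length, so the bounds are uniform in
  \<open>t\<close>.\<close>

lemma uniform_bounds:
  assumes \<Lambda>: "\<Lambda> > 0"
      "\<And>r. r \<in> {-\<rho>..\<rho>} \<Longrightarrow> \<bar>deriv f r\<bar> + 2 * max (deriv f (-\<rho>)) (- deriv f \<rho>) \<le> \<Lambda> * f r"
    and D: "\<And>r t. r \<in> {-\<rho>..\<rho>} \<Longrightarrow> 0 \<le> t \<Longrightarrow> t \<le> 1 \<Longrightarrow> - D \<le> p' r t"
    and r: "r \<in> {-\<rho>..\<rho>}" and t: "0 < t"
  shows "- (D * exp (2 * \<Lambda> * \<rho>)) \<le> p' r t" "\<bar>p r t\<bar> \<le> max (deriv f (-\<rho>)) (- deriv f \<rho>)"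
proof -
  obtain s g where s0: "s 0 = 0" and gs: "\<And>x. x \<in> {0..t + 2} \<Longrightarrow> g (s x) = x"
    and mono: "\<And>x y. 0 \<le> x \<Longrightarrow> x < y \<Longrightarrow> y \<le> t + 2 \<Longrightarrow> s x < s y"
    and g: "\<And>x. x \<in> {0..s (t + 2)} \<Longrightarrow> g x \<in> {0..t + 2}" "\<And>x. x \<in> {0..s (t + 2)} \<Longrightarrow> s (g x) = x"
    and cont_g: "continuous_on {0..s (t + 2)} g"
    and g_deriv: "\<And>x. 0 < x \<Longrightarrow> x < s (t + 2) \<Longrightarrow> (g has_real_derivative 1 / exp (- \<psi> (g x))) (at x)"
    \<comment> \<open>The end \<open>t + 2\<close> lies strictly beyond both \<open>t\<close> and 1,
      so \<open>s t\<close> and \<open>s 1\<close> are interior times.\<close>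
    by (rule time_change[of "t + 2" "\<lambda>x. exp (- \<psi> x)"]) (use t in \<open>auto intro!: continuous_intros cont_\<psi>\<close>)
  define T where "T = s (t + 2)"
  have T: "T > 0" using mono[of 0 "t + 2"] s0 t by (simp add: T_def)
  have cont_comp: "continuous_on ({-\<rho>..\<rho>} \<times> {0..T}) (\<lambda>(r, x). G r (g x))"
    if "continuous_on ({-\<rho>..\<rho>} \<times> {0..}) (\<lambda>(r, t). G r t)" for G :: "real \<Rightarrow> real \<Rightarrow> real"
  proof -
    have "continuous_on ({-\<rho>..\<rho>} \<times> {0..T}) (\<lambda>x. (\<lambda>(r, t). G r t) (fst x, g (snd x)))"
      by (rule continuous_on_compose2[OF that])
        (use g(1) in \<open>auto simp: T_def intro!: continuous_intros continuous_on_compose2[OF cont_g]\<close>)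
    then show ?thesis by (simp add: case_prod_unfold)
  qed
  have g_pos: "0 \<le> g x" if "0 \<le> x" "x \<le> T" for x using g(1)[of x] that by (simp add: T_def)
  have g0: "g 0 = 0" using gs[of 0] s0 t by simp
  interpret U: rotational_flow f "deriv f" "deriv (deriv f)" "\<lambda>r x. w r (g x) - \<psi> (g x) / 2"
    "\<lambda>r x. w1 r (g x)" "\<lambda>r x. w2 r (g x)" \<rho> T
  proof
    show "((\<lambda>r. w r (g x) - \<psi> (g x) / 2) has_real_derivative w1 r (g x)) (at r)"
      if "0 \<le> x" "x \<le> T" for r x
      using g_pos[OF that] by (auto intro!: derivative_eq_intros w_deriv)
    have "continuous_on ({-\<rho>..\<rho>} \<times> {0..T}) (\<lambda>x. \<psi> (g (snd x)))"
      by (rule continuous_on_compose2[OF cont_\<psi>[of "t + 2"]])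
        (use g(1) in \<open>auto simp: T_def intro!: continuous_intros continuous_on_compose2[OF cont_g]\<close>)
    then show "continuous_on ({-\<rho>..\<rho>} \<times> {0..T}) (\<lambda>(r, x). w r (g x) - \<psi> (g x) / 2)"
      using cont_comp[OF cont_w] by (auto simp: case_prod_unfold intro!: continuous_intros)
    show "((\<lambda>x. w r (g x) - \<psi> (g x) / 2) has_real_derivative
        exp (- 2 * (w r (g x) - \<psi> (g x) / 2)) *
          (f r * w2 r (g x) + deriv f r * w1 r (g x) + deriv (deriv f) r) / f r) (at x)"
      if r: "r \<in> {-\<rho>..\<rho>}" and x: "0 < x" "x < T" for r x
    proof -
      have "g x \<noteq> 0" using g(2)[of x] x s0 by (auto simp: T_def)
      then have "0 < g x" using g_pos[of x] x by simp
      then have "((\<lambda>x. w r (g x) - \<psi> (g x) / 2) has_real_derivative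
          exp (- 2 * w r (g x)) * p' r (g x) / f r * (1 / exp (- \<psi> (g x)))) (at x)"
        by (intro DERIV_chain2[OF rescaled_deriv[OF r]] g_deriv) (use x in \<open>auto simp: T_def\<close>)
      \<comment> \<open>The derivative of \<open>g\<close> is phi, exactly the factor that turns
        e^(-2w) into e^(-2V).\<close>
      moreover have "exp (- 2 * (w r (g x) - \<psi> (g x) / 2)) = exp (- 2 * w r (g x)) * (1 / exp (- \<psi> (g x)))"
      proof -
        have "exp (- 2 * (w r (g x) - \<psi> (g x) / 2)) = exp (- 2 * w r (g x) - - \<psi> (g x))"
          by (simp add: algebra_simps)
        then show ?thesis unfolding exp_diff by simp
      qed
      ultimately show ?thesis by (simp add: p'_def mult.commute)
    qed
    show "f r * w1 r (g x) + deriv f r = deriv f r * exp (w r (g x) - \<psi> (g x) / 2)"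
      if "r \<in> {-\<rho>, \<rho>}" "0 \<le> x" "x \<le> T" for r x
      using boundary[OF g_pos that(1)] that by (simp add: p_def)
    show "w r (g 0) - \<psi> (g 0) / 2 = 0" if "r \<in> {-\<rho>..\<rho>}" for r
      using flow that g0 by (simp add: normalised_rot_flow_def \<psi>_def)
  qed (use rho_pos T f_pos f_deriv f1_deriv f1_signs f2_nonpos cont_f2 w1_deriv g_pos
        cont_comp[OF cont_w1] cont_comp[OF cont_w2] in auto)
  have P: "U.P r x = p r (g x)" "U.P' r x = p' r (g x)" for r x
    by (simp_all add: U.P_def U.P'_def p_def p'_def)
  have st: "0 < s t" "s t < T" "g (s t) = t" "0 < s 1" "s 1 < T"
    using mono[of 0 t] mono[of t "t + 2"] mono[of 0 1] mono[of 1 "t + 2"] gs[of t] t s0 by (auto simp: T_def)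
  have "- D \<le> U.P' r x" if "r \<in> {-\<rho>..\<rho>}" "0 \<le> x" "x \<le> s 1" for r x
  proof -
    have x: "x \<in> {0..s (t + 2)}" using that st by (simp add: T_def)
    \<comment> \<open>Normalised times up to 1, where \<open>D\<close> is valid, correspond to
      unnormalised times up to \<open>s 1\<close>.\<close>
    have "g x \<le> 1" using mono[of 1 "g x"] g[OF x] that by force
    then show ?thesis using D[OF that(1)] g(1)[OF x] by (simp add: P)
  qed
  then have "- (D * exp (2 * \<Lambda> * \<rho>)) \<le> U.P' r (s t)"
    using st r \<Lambda> by (intro U.P'_lower_bound[of "s 1"]) (auto simp: U.slope_bound_def)
  then show "- (D * exp (2 * \<Lambda> * \<rho>)) \<le> p' r t" by (simp add: P st)
  show "\<bar>p r t\<bar> \<le> max (deriv f (-\<rho>)) (- deriv f \<rho>)"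
    using U.P_bound[OF r, of "s t"] st by (simp add: P U.slope_bound_def)
qed

end

section \<open>Lower bound for the conformal factor and the curvature bound\<close>

theorem theorem4p7:
  fixes f :: "real \<Rightarrow> real" and \<rho> :: real and w :: "real \<Rightarrow> real \<Rightarrow> real"
  assumes rho_pos: "\<rho> > 0"
    and f_smooth: "smooth_fun f"
    and f_pos: "\<forall>r\<in>{-\<rho>..\<rho>}. f r > 0"
    and area: "area_rot (\<lambda>_. 1) f \<rho> = 1"
    and R0_nonneg: "\<forall>r\<in>{-\<rho>..\<rho>}. scal_rot (\<lambda>_. 1) f r \<ge> 0"
    and k0_nonpos: "geod_curv_top (\<lambda>_. 1) f \<rho> \<le> 0" "geod_curv_bot (\<lambda>_. 1) f \<rho> \<le> 0"
    and reflection: "\<forall>r\<in>{-\<rho>..\<rho>}. f (- r) = f r"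
    and R0_decr: "\<forall>r\<in>{-\<rho>..\<rho>}. \<forall>s\<in>{-\<rho>..\<rho>}.
                    \<bar>r\<bar> \<le> \<bar>s\<bar> \<longrightarrow> scal_rot (\<lambda>_. 1) f s \<le> scal_rot (\<lambda>_. 1) f r"
    and flow: "normalised_rot_flow f \<rho> w"
  shows "\<exists>C. \<forall>r\<in>{-\<rho>..\<rho>}. \<forall>t\<ge>0. flow_R f w r t \<le> C"
proof -
  interpret normalised_flow f \<rho> w
    by unfold_locales (use assms in auto)
  let ?I = "{-\<rho>..\<rho>}" and ?B = "max (deriv f (-\<rho>)) (- deriv f \<rho>)"
  have I: "compact ?I" "?I \<noteq> {}" using rho_pos by auto
  obtain r0 where r0: "r0 \<in> ?I" "\<And>r. r \<in> ?I \<Longrightarrow> f r0 \<le> f r"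
    using continuous_attains_inf[OF I cont_f] by blast
  obtain F where F: "\<And>r. r \<in> ?I \<Longrightarrow> f r \<le> F"
    using continuous_attains_sup[OF I cont_f] by blast
  have fr0: "f r0 > 0" using f_pos r0 by blast
  have "continuous_on ?I (\<lambda>r. (\<bar>deriv f r\<bar> + 2 * ?B) / f r)"
    using f_pos by (intro continuous_intros cont_f cont_f1) force
  from continuous_attains_sup[OF I this]
  obtain L where L: "\<And>r. r \<in> ?I \<Longrightarrow> (\<bar>deriv f r\<bar> + 2 * ?B) / f r \<le> L" by blast
  define \<Lambda> where "\<Lambda> = max L 1"
  have \<Lambda>: "\<Lambda> > 0" "\<And>r. r \<in> ?I \<Longrightarrow> \<bar>deriv f r\<bar> + 2 * ?B \<le> \<Lambda> * f r"
  proof -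
    show "\<Lambda> > 0" by (simp add: \<Lambda>_def)
    fix r assume r: "r \<in> ?I"
    have "(\<bar>deriv f r\<bar> + 2 * ?B) / f r \<le> \<Lambda>" using L[OF r] by (simp add: \<Lambda>_def)
    then show "\<bar>deriv f r\<bar> + 2 * ?B \<le> \<Lambda> * f r" using f_pos r by (simp add: pos_divide_le_eq)
  qed
  \<comment> \<open>Compactness gives a bound on the time interval [0, 1] only;
    \<open>uniform_bounds\<close> extends it to all times.\<close>
  have "compact ((\<lambda>(r, t). p' r t) ` (?I \<times> {0..1}))"
    by (intro compact_continuous_image continuous_on_subset[OF cont_p'] compact_Times compact_Icc) auto
  then obtain D where D: "\<And>r t. r \<in> ?I \<Longrightarrow> 0 \<le> t \<Longrightarrow> t \<le> 1 \<Longrightarrow> \<bar>p' r t\<bar> \<le> D"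
    using compact_imp_bounded by (fastforce simp: bounded_iff)
  have D0: "D \<ge> 0" using D[of 0 0] rho_pos by auto
  define C where "C = D * exp (2 * \<Lambda> * \<rho>)"
  have DC: "D \<le> C" using D0 \<Lambda> rho_pos mult_left_mono[of 1 "exp (2 * \<Lambda> * \<rho>)" D] by (simp add: C_def)
  have D': "- D \<le> p' r t" if "r \<in> ?I" "0 \<le> t" "t \<le> 1" for r t using D[OF that] by linarith
  have B: "- C \<le> p' r t \<and> \<bar>p r t\<bar> \<le> ?B" if "r \<in> ?I" "0 \<le> t" for r t
  proof (cases "t = 0")
    case True
    have c: "continuous_on {0..} (\<lambda>t. (\<lambda>(r, t). p r t) (r, t))"
      by (rule continuous_on_compose2[OF cont_p]) (use that in \<open>auto intro!: continuous_intros\<close>)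
    \<comment> \<open>\<open>uniform_bounds\<close> covers positive times; the bound on
      \<open>p\<close> passes to time 0 by continuity, while \<open>p'\<close> is covered there by
      \<open>D\<close>.\<close>
    have "continuous_on (closure {0<..}) (\<lambda>t. \<bar>p r t\<bar>)"
      using c by (auto intro!: continuous_intros)
    then have "\<bar>p r 0\<bar> \<le> ?B"
      by (rule continuous_le_on_closure) (use uniform_bounds(2)[OF \<Lambda> D' that(1)] in auto)
    then show ?thesis using True D'[OF that(1), of 0] DC by auto
  next
    case False
    then show ?thesis using uniform_bounds[OF \<Lambda> D' that(1), of t] that by (auto simp: C_def)
  qed
  \<comment> \<open>\<open>A\<close> comes from the unit area: 1 is at most 2 pi times the interval
    length \<open>2 * \<rho>\<close> times the largest possible density, expressed through
    \<open>w\<close> at a single point.\<close>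
  define A where "A = 4 * pi * \<rho> * exp (4 * \<Lambda> * \<rho>) * F"
  have A: "exp (- 2 * w r t) \<le> A" if r: "r \<in> ?I" and t: "0 \<le> t" for r t
  proof -
    \<comment> \<open>From \<open>p = f * w1 + deriv f\<close>, the bound on \<open>p\<close>
      controls \<open>w1\<close>, and hence the oscillation of \<open>w\<close> at each
      time.\<close>
    have slope: "\<bar>w1 s t\<bar> \<le> \<Lambda>" if s: "s \<in> ?I" for s
    proof -
      have "f s > 0" using f_pos s by blast
      then have "f s * \<bar>w1 s t\<bar> = \<bar>p s t - deriv f s\<bar>" by (simp add: p_def abs_mult)
      also have "\<dots> \<le> f s * \<Lambda>"
      proof -
        have "?B \<ge> 0" using f1_signs by simp
        then have "\<bar>p s t - deriv f s\<bar> \<le> \<bar>deriv f s\<bar> + 2 * ?B" using B[OF s t] by linarith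
        then show ?thesis using \<Lambda>(2)[OF s] by (simp add: mult.commute)
      qed
      finally show ?thesis using f_pos s by simp
    qed
    have osc: "w s t \<le> w r t + 2 * \<Lambda> * \<rho>" if s: "s \<in> ?I" for s
    proof -
      have "norm (w s t - w r t) \<le> \<Lambda> * norm (s - r)"
        by (rule field_differentiable_bound[of ?I _ "\<lambda>s. w1 s t"])
          (use slope s r t in \<open>auto intro: has_field_derivative_at_within[OF w_deriv]\<close>)
      moreover have "\<Lambda> * \<bar>s - r\<bar> \<le> \<Lambda> * (2 * \<rho>)" using s r \<Lambda> by (intro mult_left_mono) auto
      ultimately show ?thesis by auto
    qed
    let ?c = "exp (2 * w r t) * exp (4 * \<Lambda> * \<rho>) * F"
    have "continuous_on ?I (\<lambda>s. w s t)"
      by (intro continuous_at_imp_continuous_on ballI DERIV_continuous[OF w_deriv[OF t]])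
    then have int: "(\<lambda>s. exp (w s t) * (exp (w s t) * f s)) integrable_on ?I"
      by (intro integrable_continuous_real continuous_intros cont_f)
    have "integral ?I (\<lambda>s. exp (w s t) * (exp (w s t) * f s)) \<le> integral ?I (\<lambda>s. ?c)"
    proof (rule integral_le[OF int])
      fix s assume s: "s \<in> ?I"
      have "exp (w s t) * exp (w s t) = exp (2 * w s t)" by (simp add: exp_add[symmetric])
      also have "\<dots> \<le> exp (2 * w r t + 4 * \<Lambda> * \<rho>)" using osc[OF s] by simp
      finally have "(exp (w s t) * exp (w s t)) * f s \<le> exp (2 * w r t + 4 * \<Lambda> * \<rho>) * F"
        using F[OF s] f_pos s by (intro mult_mono) (auto intro: less_imp_le)
      then show "exp (w s t) * (exp (w s t) * f s) \<le> ?c" by (simp add: exp_add mult.assoc)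
    qed (intro integrable_continuous_real continuous_intros)
    also have "\<dots> = 2 * \<rho> * ?c" using rho_pos by simp
    finally have "2 * pi * integral ?I (\<lambda>s. exp (w s t) * (exp (w s t) * f s)) \<le> 2 * pi * (2 * \<rho> * ?c)"
      by (intro mult_left_mono) auto
    moreover have "2 * pi * integral ?I (\<lambda>s. exp (w s t) * (exp (w s t) * f s)) = 1"
      using flow t unfolding normalised_rot_flow_def area_rot_def flow_a_def flow_b_def by blast
    moreover have "2 * pi * (2 * \<rho> * ?c) = exp (2 * w r t) * A" by (simp add: A_def)
    ultimately have "1 \<le> exp (2 * w r t) * A" by linarith
    then have "exp (- 2 * w r t) * 1 \<le> exp (- 2 * w r t) * (exp (2 * w r t) * A)"
      by (intro mult_left_mono) auto
    also have "\<dots> = (exp (- 2 * w r t) * exp (2 * w r t)) * A" by simp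
    also have "\<dots> = A" by (simp add: exp_add[symmetric])
    finally show ?thesis by simp
  qed
  show ?thesis
  proof (intro exI ballI allI impI)
    fix r t assume r: "r \<in> ?I" and t: "(0::real) \<le> t"
    have "C \<ge> 0" using D0 DC by linarith
    have "- p' r t \<le> C" using B[OF r t] by simp
    then have "exp (- 2 * w r t) * (- p' r t) \<le> exp (- 2 * w r t) * C" by (intro mult_left_mono) auto
    also have "\<dots> \<le> A * C" using A[OF r t] \<open>C \<ge> 0\<close> by (intro mult_right_mono) auto
    finally have 1: "exp (- 2 * w r t) * (- p' r t) \<le> A * C" .
    have "A \<ge> 0" using A[OF r t] by (smt (verit) exp_gt_zero)
    \<comment> \<open>The curvature factors into e^(-2w), bounded by \<open>A\<close>, then
      \<open>- p'\<close>, bounded by \<open>C\<close>, and 1/f, largest at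
      \<open>r0\<close>.\<close>
    have "flow_R f w r t = 2 * (exp (- 2 * w r t) * (- p' r t)) / f r"
      by (simp add: flow_R_eq[OF t])
    also have "\<dots> \<le> 2 * (A * C) / f r" using 1 r0(2)[OF r] fr0
      by (intro divide_right_mono mult_left_mono) linarith+
    also have "\<dots> \<le> 2 * (A * C) / f r0"
      using r0(2)[OF r] fr0 \<open>A \<ge> 0\<close> \<open>C \<ge> 0\<close> mult_pos_pos[of "f r" "f r0"]
      by (intro divide_left_mono) auto
    finally show "flow_R f w r t \<le> 2 * (A * C) / f r0" .
  qed
qed

end
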